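(* Let $n\ge1$. As a $\rho(Sp(n)U(1))$-representation, the space $\mathfrak{R}$ of algebraic tensors with the properties of the Riemannian curvature tensor of a Hermitian manifold with $Hol(\nabla^a)=\rho(Sp(n)U(1))$ and $\nabla^aT^a=0$ is $\mathfrak{R}\cong\mathbb{R}\oplus r(S^4E)$. With respect to this isomorphism, for $R\in\mathfrak{R}$ with corresponding torsion $T^a=\lambda T_0+\bar\lambda\overline{T}_0$, $\lambda\in\mathbb{C}$, we have $$R=\frac{|T^a|^2}{48n}R_0+R_{hyper},$$ where $R_{hyper}$ has the properties of an algebraic hyper-Kähler curvature tensor on $\mathcal{H}$ and $$\begin{aligned}R_0(X,Y,Z,W)=\;&R^{g_{|\mathcal{H}}}_{\mathbb{H}P^n}(X,Y,Z,W)\\&-\tfrac12\sum_{L\in\{I,K\}}\big(g_{|\mathcal{H}}(LY,Z)g_{|\mathcal{H}}(LX,W)-g_{|\mathcal{H}}(LX,Z)g_{|\mathcal{H}}(LY,W)-2g_{|\mathcal{H}}(LX,Y)g_{|\mathcal{H}}(LZ,W)\big)\\&+\tfrac12\big(g_{|\mathcal{H}}(Y,Z)g_{|\mathcal{V}}(X,W)+g_{|\mathcal{V}}(Y,Z)g_{|\mathcal{H}}(X,W)-g_{|\mathcal{H}}(X,Z)g_{|\mathcal{V}}(Y,W)-g_{|\mathcal{V}}(X,Z)g_{|\mathcal{H}}(Y,W)\big)\\&+\tfrac32\big(g_{|\mathcal{H}}(JY,Z)g_{|\mathcal{V}}(JX,W)+g_{|\mathcal{V}}(JY,Z)g_{|\mathcal{H}}(JX,W)-g_{|\mathcal{H}}(JX,Z)g_{|\mathcal{V}}(JY,W)-g_{|\mathcal{V}}(JX,Z)g_{|\mathcal{H}}(JY,W)\\&\qquad-2g_{|\mathcal{H}}(JX,Y)g_{|\mathcal{V}}(JZ,W)-2g_{|\mathcal{V}}(JX,Y)g_{|\mathcal{H}}(JZ,W)\big)\\&-8g_{|\mathcal{V}}(JX,Y)g_{|\mathcal{V}}(JZ,W),\end{aligned}$$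 with $$\begin{aligned}R^{g_{|\mathcal{H}}}_{\mathbb{H}P^n}(X,Y,Z,W)=\;&g_{|\mathcal{H}}(Y,Z)g_{|\mathcal{H}}(X,W)-g_{|\mathcal{H}}(X,Z)g_{|\mathcal{H}}(Y,W)\\&+\sum_{L\in\{I,J,K\}}\big(g_{|\mathcal{H}}(LY,Z)g_{|\mathcal{H}}(LX,W)-g_{|\mathcal{H}}(LX,Z)g_{|\mathcal{H}}(LY,W)-2g_{|\mathcal{H}}(LX,Y)g_{|\mathcal{H}}(LZ,W)\big).\end{aligned}$$ The Ricci tensor $Ric$ and the scalar curvature $s$ of $R$ are $$Ric=\frac{|T^a|^2}{24n}\big((2n+3)g_{|\mathcal{H}}+(n+4)g_{|\mathcal{V}}\big),\qquad s=\frac{(4n^2+7n+4)|T^a|^2}{12n}.$$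
   Context: $Sp(n)U(1)=\{ab: a\in Sp(n),b\in U(1)\}\subset U(2n)$ ($U(1)$ acting by scalars), and $\rho:Sp(n)U(1)\to U(2n)\times U(1)\subset U(2n+1)\subset SO(4n+2)$ is $\rho(ab)=\begin{pmatrix}ab&0\\0&b^2\end{pmatrix}$. $T=\mathcal{H}\oplus\mathcal{V}\cong\mathbb{C}^{2n}\oplus\mathbb{C}$ is the standard real $(4n+2)$-dimensional representation with inner product $g$ and complex structure $J$; $e_1,\dots,e_{2n}$ and $e_{2n+1}$ are the standard unitary bases of $\mathcal{H}^{1,0}$ and $\mathcal{V}^{1,0}$ (so $g(e_i,\bar e_j)=\delta_{ij}$ for the complex bilinear extension of $g$), with dual basis $e^1,\dots,e^{2n+1}$. Put $\omega_0=\sum_{k=1}^ne^{2k-1}\wedge e^{2k}$ ($Sp(n)$ is the stabilizer of $\omega_0$ in $U(2n)$) and $T_0=\omega_0\wedge\bar e^{2n+1}$. $K,I\in End(T)$ are the real endomorphisms defined by $g((K+iI)X,Y)=2\omega_0(X,Y)$; they vanish on $\mathcal{V}$, preserve $\mathcal{H}$, and on $\mathcal{H}$ the maps $I,J,K$ are orthogonal and satisfy the quaternionic identities. $g_{|\mathcal{H}}$, $g_{|\mathcal{V}}$ are the restrictions of $g$ extended by zero. For a real 3-form $\Theta$ on $T$, let $g(\Theta(X,Y),Z)=\Theta(X,Y,Z)$ and $\sigma_\Theta(X,Y,Z,W)=\mathfrak{S}_{X,Y,Z}\,g(\Theta(X,Y),\Theta(Z,W))$ (cyclic sum); $(bR)(X,Y,Z,W)=\mathfrak{S}_{X,Y,Z}R(X,Y,Z,W)$.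 Let $\mathfrak{R}^a=S^2(\rho(sp(n)\oplus u(1)))\cap b^{-1}(\mathbb{R}\,\sigma_{T_0+\overline T_0})\subset(T^* )^{\otimes4}$, where $\rho(sp(n)\oplus u(1))\subset so(T)\cong\Lambda^2T^*$ is the Lie algebra of $\rho(Sp(n)U(1))$ (this is the space of algebraic tensors with the properties of the curvature tensor of $\nabla^a$, the Hermitian connection with totally skew-symmetric torsion $T^a$, on a Hermitian manifold with $Hol(\nabla^a)=\rho(Sp(n)U(1))$, $\nabla^aT^a=0$). For a real 3-form $\Theta$ put $$q_\Theta(X,Y,Z,W)=\tfrac12g(\Theta(X,Y),\Theta(Z,W))+\tfrac14g(\Theta(Y,Z),\Theta(X,W))-\tfrac14g(\Theta(X,Z),\Theta(Y,W));$$ on a manifold with $\nabla^aT^a=0$ the curvature $R^a$ of $\nabla^a$ and the Riemannian curvature $R$ are related by $R^a=R+q_{T^a}$. Accordingly $\mathfrak{R}$ is the real vector space of tensors $R=R^a-c\,q_{T_0+\overline T_0}$ with $R^a\in\mathfrak{R}^a$ and $bR^a=c\,\sigma_{T_0+\overline T_0}$, $c\in\mathbb{R}$. $R\in\mathfrak R$ has corresponding torsion $T^a=\lambda T_0+\bar\lambda\overline T_0$ when $c=|\lambda|^2$, i.e. $bR^a=\sigma_{T^a}$ and $R=R^a-q_{T^a}$. $|T^a|^2$ is the tensorial norm (sum of squares of all components in a $g$-orthonormal basis), so $|T^a|^2=12n|\lambda|^2$. $E$ is the standard $2n$-dimensional complex representation of $Sp(n)$; $r(S^4E)$ is the real representation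 underlying $S^4E$, i.e. the real form with $r(S^4E)\otimes\mathbb{C}\cong S^4E$ ($U(1)$ acts trivially). An algebraic hyper-Kähler curvature tensor on $\mathcal{H}$ is an algebraic curvature tensor on $\mathcal{H}$ (all symmetries of a Riemannian curvature tensor; extended by zero to $T$) such that each $R(X,Y)$ commutes with $I,J,K$. Conventions: $R(X,Y,Z,W)=g(R(X,Y)Z,W)$, $Ric(Y,Z)=\sum_iR(\varepsilon_i,Y,Z,\varepsilon_i)$ for a $g$-orthonormal basis $\{\varepsilon_i\}$, and the scalar curvature is the $g$-trace of $Ric$. *)

theory Defs
  imports "HOL-Analysis.Analysis"
begin

text \<open>
  The integer \<open>n \<ge> 1\<close> is \<open>CARD('n)\<close>. The coordinates of \<open>\<H> = \<complex>\<^sup>2\<^sup>n\<close> are indexed by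
  \<open>'n + 'n\<close>: \<open>Inl k\<close> and \<open>Inr k\<close> stand for the indices \<open>2k - 1\<close> and \<open>2k\<close>.
  The real inner product \<open>\<bullet>\<close> of the product type is the metric \<open>g\<close> on \<open>T\<close>.
\<close>

type_synonym 'n hor = "complex ^ ('n + 'n)"
type_synonym 'n tsp = "'n hor \<times> complex"
type_synonym 'n mat2n = "complex ^ ('n + 'n) ^ ('n + 'n)"
type_synonym 'n quartic = "complex ^ ('n + 'n) ^ ('n + 'n) ^ ('n + 'n) ^ ('n + 'n)"
type_synonym 'n form2 = "'n tsp \<Rightarrow> 'n tsp \<Rightarrow> real"
type_synonym 'n form3 = "'n tsp \<Rightarrow> 'n tsp \<Rightarrow> 'n tsp \<Rightarrow> real"
type_synonym 'n tensor4 = "'n tsp \<Rightarrow> 'n tsp \<Rightarrow> 'n tsp \<Rightarrow> 'n tsp \<Rightarrow> real"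

definition gH :: "'n::finite form2" where
  "gH X Y = fst X \<bullet> fst Y"

definition gV :: "'n::finite form2" where
  "gV X Y = snd X \<bullet> snd Y"

definition riesz :: "('v::euclidean_space \<Rightarrow> real) \<Rightarrow> 'v" where
  "riesz f = (THE V. \<forall>Z. V \<bullet> Z = f Z)"

text \<open>
  For the standard real orthonormal basis \<open>\<epsilon>\<^sub>i, J \<epsilon>\<^sub>i\<close> of \<open>T\<close>, the unitary basis normalised by
  \<open>g(e\<^sub>i, cnj e\<^sub>j) = \<delta>\<^sub>i\<^sub>j\<close> is \<open>e\<^sub>i = (\<epsilon>\<^sub>i - \<i> J \<epsilon>\<^sub>i) / \<surd>2\<close>. On a real vector with complex coordinates \<open>z\<close>
  the dual 1-form \<open>e\<^sup>i\<close> therefore takes the value \<open>z\<^sub>i / \<surd>2\<close>.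
\<close>

definition eH :: "'n + 'n \<Rightarrow> 'n::finite tsp \<Rightarrow> complex" where
  "eH i X = fst X $ i / complex_of_real (sqrt 2)"

definition eV :: "'n::finite tsp \<Rightarrow> complex" where
  "eV X = snd X / complex_of_real (sqrt 2)"

definition wedge11 :: "('v \<Rightarrow> complex) \<Rightarrow> ('v \<Rightarrow> complex) \<Rightarrow> 'v \<Rightarrow> 'v \<Rightarrow> complex" where
  "wedge11 \<alpha> \<beta> X Y = \<alpha> X * \<beta> Y - \<alpha> Y * \<beta> X"

definition wedge21 :: "('v \<Rightarrow> 'v \<Rightarrow> complex) \<Rightarrow> ('v \<Rightarrow> complex) \<Rightarrow> 'v \<Rightarrow> 'v \<Rightarrow> 'v \<Rightarrow> complex" where
  "wedge21 \<omega> \<beta> X Y Z = \<omega> X Y * \<beta> Z + \<omega> Y Z * \<beta> X + \<omega> Z X * \<beta> Y"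

definition omega0 :: "'n::finite tsp \<Rightarrow> 'n tsp \<Rightarrow> complex" where
  "omega0 X Y = (\<Sum>k\<in>UNIV. wedge11 (eH (Inl k)) (eH (Inr k)) X Y)"

definition T0 :: "'n::finite tsp \<Rightarrow> 'n tsp \<Rightarrow> 'n tsp \<Rightarrow> complex" where
  "T0 = wedge21 omega0 (\<lambda>X. cnj (eV X))"

text \<open>The argument of \<open>Re\<close> is real: \<open>torsion l\<close> is the real 3-form \<open>l T\<^sub>0 + cnj (l T\<^sub>0)\<close>.\<close>

definition torsion :: "complex \<Rightarrow> 'n::finite form3" where
  "torsion l X Y Z = Re (l * T0 X Y Z + cnj l * cnj (T0 X Y Z))"

definition norm2_form3 :: "'n::finite form3 \<Rightarrow> real" where
  "norm2_form3 \<Theta> = (\<Sum>u\<in>Basis. \<Sum>v\<in>Basis. \<Sum>w\<in>Basis. (\<Theta> u v w)\<^sup>2)"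

definition JJ :: "'n::finite tsp \<Rightarrow> 'n tsp" where
  "JJ X = (\<i> *s fst X, \<i> * snd X)"

text \<open>\<open>K\<close> and \<open>I\<close>, from the real and imaginary parts of \<open>g((K + \<i> I) X, Y) = 2 \<omega>\<^sub>0(X, Y)\<close>.\<close>

definition KK :: "'n::finite tsp \<Rightarrow> 'n tsp" where
  "KK X = riesz (\<lambda>Y. Re (2 * omega0 X Y))"

definition II :: "'n::finite tsp \<Rightarrow> 'n tsp" where
  "II X = riesz (\<lambda>Y. Im (2 * omega0 X Y))"

definition U2n :: "'n::finite mat2n set" where
  "U2n = {A. A ** (\<chi> i j. cnj (A $ j $ i)) = mat 1}"

definition Sp :: "'n::finite mat2n set" where
  "Sp = {A \<in> U2n. \<forall>x y. omega0 (A *v x, 0) (A *v y, 0) = omega0 (x, 0) (y, 0)}"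

text \<open>
  \<open>rho a b\<close> is \<open>\<rho>(ab)\<close>; it depends on the product only, because \<open>ab = a'b'\<close> forces
  \<open>(a', b') = \<plusminus>(a, b)\<close>.
\<close>

definition rho :: "'n mat2n \<Rightarrow> complex \<Rightarrow> 'n::finite tsp \<Rightarrow> 'n tsp" where
  "rho a b X = (b *s (a *v fst X), b\<^sup>2 * snd X)"

definition rho_group :: "('n::finite tsp \<Rightarrow> 'n tsp) set" where
  "rho_group = {rho a b |a b. a \<in> Sp \<and> cmod b = 1}"

text \<open>The tangent space at the identity of a closed group of linear maps.\<close>

definition lie_algebra :: "('v::euclidean_space \<Rightarrow> 'v) set \<Rightarrow> ('v \<Rightarrow> 'v) set" where
  "lie_algebra G = {A. \<exists>\<gamma> :: real \<Rightarrow> 'v \<Rightarrow> 'v. (\<forall>t. \<gamma> t \<in> G) \<and> \<gamma> 0 = id \<and>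
     (\<forall>X. ((\<lambda>t. \<gamma> t X) has_vector_derivative A X) (at 0))}"

definition rho_forms :: "'n::finite form2 set" where
  "rho_forms = {(\<lambda>X Y. A X \<bullet> Y) |A. A \<in> lie_algebra rho_group}"

text \<open>\<open>S\<^sup>2\<close> of a linear space of 2-forms; scalar factors are absorbed in \<open>\<alpha>\<close>.\<close>

definition sym_square :: "'n::finite form2 set \<Rightarrow> 'n tensor4 set" where
  "sym_square \<GG> = {R. \<exists>(m::nat) \<alpha> \<beta>. (\<forall>i<m. \<alpha> i \<in> \<GG> \<and> \<beta> i \<in> \<GG>) \<and>
     R = (\<lambda>X Y Z W. \<Sum>i<m. \<alpha> i X Y * \<beta> i Z W + \<beta> i X Y * \<alpha> i Z W)}"

definition bianchi :: "'n::finite tensor4 \<Rightarrow> 'n tensor4" where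
  "bianchi R X Y Z W = R X Y Z W + R Y Z X W + R Z X Y W"

definition tvec :: "'n::finite form3 \<Rightarrow> 'n tsp \<Rightarrow> 'n tsp \<Rightarrow> 'n tsp" where
  "tvec \<Theta> X Y = riesz (\<lambda>Z. \<Theta> X Y Z)"

definition sigma :: "'n::finite form3 \<Rightarrow> 'n tensor4" where
  "sigma \<Theta> = bianchi (\<lambda>X Y Z W. tvec \<Theta> X Y \<bullet> tvec \<Theta> Z W)"

definition qtensor :: "'n::finite form3 \<Rightarrow> 'n tensor4" where
  "qtensor \<Theta> X Y Z W = 1/2 * (tvec \<Theta> X Y \<bullet> tvec \<Theta> Z W)
     + 1/4 * (tvec \<Theta> Y Z \<bullet> tvec \<Theta> X W) - 1/4 * (tvec \<Theta> X Z \<bullet> tvec \<Theta> Y W)"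

text \<open>\<open>torsion 1 = T\<^sub>0 + cnj T\<^sub>0\<close>.\<close>

definition RRa :: "'n::finite tensor4 set" where
  "RRa = {Ra \<in> sym_square rho_forms.
     \<exists>c. bianchi Ra = (\<lambda>X Y Z W. c * sigma (torsion 1) X Y Z W)}"

definition RR :: "'n::finite tensor4 set" where
  "RR = {R. \<exists>Ra\<in>RRa. \<exists>c.
     bianchi Ra = (\<lambda>X Y Z W. c * sigma (torsion 1) X Y Z W) \<and>
     R = (\<lambda>X Y Z W. Ra X Y Z W - c * qtensor (torsion 1) X Y Z W)}"

definition corresponding_torsion :: "'n::finite tensor4 \<Rightarrow> complex \<Rightarrow> bool" where
  "corresponding_torsion R l \<longleftrightarrow> (\<exists>Ra\<in>RRa. bianchi Ra = sigma (torsion l) \<and>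
     R = (\<lambda>X Y Z W. Ra X Y Z W - qtensor (torsion l) X Y Z W))"

definition tensor_act :: "('n::finite tsp \<Rightarrow> 'n tsp) \<Rightarrow> 'n tensor4 \<Rightarrow> 'n tensor4" where
  "tensor_act h R X Y Z W = R (inv h X) (inv h Y) (inv h Z) (inv h W)"

text \<open>
  \<open>S\<^sup>4 E\<close> as the symmetric tensors in \<open>E\<^sup>\<otimes>\<^sup>4\<close>, \<open>E = \<complex>\<^sup>2\<^sup>n\<close>, given by their components. The quaternionic
  structure \<open>j\<close> of \<open>E\<close> is the antilinear map commuting with \<open>Sp(n)\<close> and with \<open>j\<^sup>2 = -1\<close>, that is
  \<open>j e\<^sub>2\<^sub>k\<^sub>-\<^sub>1 = e\<^sub>2\<^sub>k\<close>, \<open>j e\<^sub>2\<^sub>k = -e\<^sub>2\<^sub>k\<^sub>-\<^sub>1\<close>. Hence \<open>j z = M (cnj z)\<close> with \<open>M = jmat\<close>, and \<open>r(S\<^sup>4 E)\<close> is the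
  fixed space of the real structure \<open>j\<^sup>\<otimes>\<^sup>4\<close> on \<open>S\<^sup>4 E\<close>.
\<close>

definition S4_act :: "'n mat2n \<Rightarrow> 'n::finite quartic \<Rightarrow> 'n quartic" where
  "S4_act a s = (\<chi> i j k l. \<Sum>p\<in>UNIV. \<Sum>q\<in>UNIV. \<Sum>r\<in>UNIV. \<Sum>t\<in>UNIV.
     a $ i $ p * a $ j $ q * a $ k $ r * a $ l $ t * s $ p $ q $ r $ t)"

definition S4E :: "'n::finite quartic set" where
  "S4E = {s. \<forall>i j k l. s $ i $ j $ k $ l = s $ j $ i $ k $ l \<and>
     s $ i $ j $ k $ l = s $ i $ k $ j $ l \<and> s $ i $ j $ k $ l = s $ i $ j $ l $ k}"

definition jmat :: "'n::finite mat2n" where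
  "jmat = (\<chi> i p. case (i, p) of
      (Inr k, Inl m) \<Rightarrow> if k = m then 1 else 0
    | (Inl k, Inr m) \<Rightarrow> if k = m then - 1 else 0
    | _ \<Rightarrow> 0)"

definition rS4E :: "'n::finite quartic set" where
  "rS4E = {s \<in> S4E. S4_act jmat (\<chi> i j k l. cnj (s $ i $ j $ k $ l)) = s}"

definition curvature_tensor :: "'n::finite tensor4 \<Rightarrow> bool" where
  "curvature_tensor R \<longleftrightarrow>
     (\<forall>Y Z W. linear (\<lambda>X. R X Y Z W)) \<and> (\<forall>X Z W. linear (\<lambda>Y. R X Y Z W)) \<and>
     (\<forall>X Y W. linear (\<lambda>Z. R X Y Z W)) \<and> (\<forall>X Y Z. linear (\<lambda>W. R X Y Z W)) \<and>
     (\<forall>X Y Z W. R X Y Z W = - R Y X Z W \<and> R X Y Z W = - R X Y W Z \<and>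
        R X Y Z W = R Z W X Y \<and> bianchi R X Y Z W = 0)"

definition hproj :: "'n::finite tsp \<Rightarrow> 'n tsp" where
  "hproj X = (fst X, 0)"

definition curv_op :: "'n::finite tensor4 \<Rightarrow> 'n tsp \<Rightarrow> 'n tsp \<Rightarrow> 'n tsp \<Rightarrow> 'n tsp" where
  "curv_op R X Y Z = riesz (\<lambda>W. R X Y Z W)"

text \<open>The second conjunct says that \<open>R\<close> is a tensor on \<open>\<H>\<close> extended by zero to \<open>T\<close>.\<close>

definition hyperkaehler_curvature :: "'n::finite tensor4 \<Rightarrow> bool" where
  "hyperkaehler_curvature R \<longleftrightarrow> curvature_tensor R \<and>
     (\<forall>X Y Z W. R X Y Z W = R (hproj X) (hproj Y) (hproj Z) (hproj W)) \<and>
     (\<forall>X Y. \<forall>L\<in>{II, JJ, KK}. curv_op R X Y \<circ> L = L \<circ> curv_op R X Y)"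

definition Lterm :: "('n::finite tsp \<Rightarrow> 'n tsp) \<Rightarrow> 'n tensor4" where
  "Lterm L X Y Z W =
     gH (L Y) Z * gH (L X) W - gH (L X) Z * gH (L Y) W - 2 * gH (L X) Y * gH (L Z) W"

definition R_HP :: "'n::finite tensor4" where
  "R_HP X Y Z W = gH Y Z * gH X W - gH X Z * gH Y W + (\<Sum>L\<leftarrow>[II, JJ, KK]. Lterm L X Y Z W)"

definition R0 :: "'n::finite tensor4" where
  "R0 X Y Z W = R_HP X Y Z W
     - 1/2 * (\<Sum>L\<leftarrow>[II, KK]. Lterm L X Y Z W)
     + 1/2 * (gH Y Z * gV X W + gV Y Z * gH X W - gH X Z * gV Y W - gV X Z * gH Y W)
     + 3/2 * (gH (JJ Y) Z * gV (JJ X) W + gV (JJ Y) Z * gH (JJ X) W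
            - gH (JJ X) Z * gV (JJ Y) W - gV (JJ X) Z * gH (JJ Y) W
            - 2 * gH (JJ X) Y * gV (JJ Z) W - 2 * gV (JJ X) Y * gH (JJ Z) W)
     - 8 * gV (JJ X) Y * gV (JJ Z) W"

definition Ric :: "'n::finite tensor4 \<Rightarrow> 'n form2" where
  "Ric R Y Z = (\<Sum>e\<in>Basis. R e Y Z e)"

definition scal :: "'n::finite tensor4 \<Rightarrow> real" where
  "scal R = (\<Sum>e\<in>Basis. Ric R e e)"

end

theory Submission
  imports Defs
begin

text \<open>
  Write \<open>q\<close> for \<open>qtensor (torsion 1)\<close>. The tensor \<open>R0 + 4 q\<close> is an explicit element of \<open>S\<^sup>2(sp(n) \<oplus> u(1))\<close> with
  Bianchi sum \<open>4 \<sigma>\<close>, so every \<open>R\<^sup>a\<close> with Bianchi sum \<open>c \<sigma>\<close> differs from \<open>c/4 (R0 + 4 q)\<close> by an element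
  of the kernel of the Bianchi map. The kernel consists of hyper-Kaehler curvature tensors on \<open>\<H>\<close>, and these
  are the real totally symmetric quartic tensors, via
  \<open>R(x, y, z, w) = Re (S(x, K y, z, K w) - S(y, K x, z, K w))\<close>.
  A hyper-Kaehler tensor is Ricci flat, so the Ricci and scalar curvatures are those of \<open>R0\<close>.
\<close>

section \<open>Hermitian, symplectic and quaternionic structure of the horizontal space\<close>

text \<open>All tensors are written in two complex-valued forms, the hermitian form
  \<open>herm\<close> and the symplectic form \<open>sympl\<close>, which K turns into each other.
  The curvature identities thereby become polynomial identities modulo the symmetries of these two
  forms. The structural obstacle is the holonomy algebra, which is given only through curves in the
  group. One inclusion differentiates identities that hold on the whole group, the other needs an
  explicit curve for each endomorphism in sp(n), and the Cayley transform provides it. That the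
  Bianchi kernel is r(\<open>S^4 E\<close>) has a conceptual reason: the complexification of sp(n)
  is \<open>S^2 E\<close>, and the Bianchi identity permits the exchange of slots belonging to
  different pairs, so a symmetric tensor on \<open>S^2 E\<close> becomes symmetric in all four
  slots. The coefficient in the theorem is c/4 with c = |\<lambda>|^2, rewritten by |T^a|^2 = 12 n
  c.\<close>

definition herm :: "'n::finite hor \<Rightarrow> 'n hor \<Rightarrow> complex" where
  "herm x y = (\<Sum>i\<in>UNIV. x $ i * cnj (y $ i))"

definition sympl :: "'n::finite hor \<Rightarrow> 'n hor \<Rightarrow> complex" where
  "sympl x y = (\<Sum>k\<in>UNIV. x $ Inl k * y $ Inr k - x $ Inr k * y $ Inl k)"

text \<open>This is K on \<H> and also the quaternionic structure j of E, so one antilinear map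
  serves both the curvature symmetries and the real structure of \<open>S^4 E\<close>.\<close>

definition quat :: "'n::finite hor \<Rightarrow> 'n hor" where
  "quat x = (\<chi> i. case i of Inl k \<Rightarrow> - cnj (x $ Inr k) | Inr k \<Rightarrow> cnj (x $ Inl k))"

lemma sum_plus_type:
  "(\<Sum>i\<in>UNIV. f i :: 'c::comm_monoid_add) = (\<Sum>k\<in>UNIV. f (Inl k)) + (\<Sum>k\<in>UNIV. f (Inr k :: 'a::finite + 'b::finite))"
  using sum.Plus[of "UNIV :: 'a set" "UNIV :: 'b set" f] by (simp add: comp_def)

lemma quat_nth [simp]:
  "quat x $ Inl k = - cnj (x $ Inr k)" "quat x $ Inr k = cnj (x $ Inl k)"
  by (simp_all add: quat_def)

lemma scaleR_eq_smult: "r *\<^sub>R (x::'n::finite hor) = complex_of_real r *s x"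
  by (simp add: vec_eq_iff scaleR_conv_of_real[where 'a=complex])

lemma inner_herm: "x \<bullet> y = Re (herm x y)"
  by (simp add: inner_vec_def herm_def inner_complex_def)

lemma herm_simps [simp]:
  "herm (x + y) z = herm x z + herm y z" "herm z (x + y) = herm z x + herm z y"
  "herm (x - y) z = herm x z - herm y z" "herm z (x - y) = herm z x - herm z y"
  "herm (- x) z = - herm x z" "herm z (- x) = - herm z x"
  "herm (c *s x) z = c * herm x z" "herm z (c *s x) = cnj c * herm z x"
  "herm (r *\<^sub>R x) z = of_real r * herm x z" "herm z (r *\<^sub>R x) = of_real r * herm z x"
  "herm 0 z = 0" "herm z 0 = 0"
  by (simp_all add: herm_def algebra_simps sum.distrib sum_subtractf sum_negf sum_distrib_left
      scaleR_conv_of_real[where 'a=complex])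

lemma sympl_simps [simp]:
  "sympl (x + y) z = sympl x z + sympl y z" "sympl z (x + y) = sympl z x + sympl z y"
  "sympl (x - y) z = sympl x z - sympl y z" "sympl z (x - y) = sympl z x - sympl z y"
  "sympl (- x) z = - sympl x z" "sympl z (- x) = - sympl z x"
  "sympl (c *s x) z = c * sympl x z" "sympl z (c *s x) = c * sympl z x"
  "sympl (r *\<^sub>R x) z = of_real r * sympl x z" "sympl z (r *\<^sub>R x) = of_real r * sympl z x"
  "sympl 0 z = 0" "sympl z 0 = 0"
  by (simp_all add: sympl_def algebra_simps sum.distrib sum_subtractf sum_negf sum_distrib_left
      scaleR_conv_of_real[where 'a=complex])

lemma herm_commute: "herm y x = cnj (herm x y)"
  by (simp add: herm_def mult.commute)

lemma sympl_commute: "sympl y x = - sympl x y"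
  by (simp add: sympl_def sum_negf[symmetric] algebra_simps)

text \<open>\<open>herm\<close> and \<open>sympl\<close> are the two components of one
  quaternion-valued form, so a \<open>quat\<close> in an argument only exchanges them. As simp
  rules, this and the next three facts remove \<open>quat\<close> from every expression in the two
  forms.\<close>

lemma herm_quat_left [simp]: "herm (quat x) y = cnj (sympl x y)"
  by (simp add: herm_def sympl_def sum_plus_type sum_subtractf sum_negf sum.distrib)

lemma sympl_quat_right [simp]: "sympl x (quat y) = herm x y"
  by (simp add: herm_def sympl_def sum_plus_type sum_subtractf sum_negf sum.distrib)

lemma sympl_quat_left [simp]: "sympl (quat x) y = - cnj (herm x y)"
  using sympl_commute[of "quat x" y] herm_commute[of y x] by simp

lemma herm_quat_right [simp]: "herm x (quat y) = - sympl x y"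
  using herm_commute[of x "quat y"] sympl_commute[of y x] by simp

lemma quat_simps [simp]:
  "quat (x + y) = quat x + quat y" "quat (x - y) = quat x - quat y" "quat (- x) = - quat x"
  "quat (c *s x) = cnj c *s quat x" "quat (r *\<^sub>R x) = r *\<^sub>R quat x"
  "quat (quat x) = - x" "quat 0 = 0"
  by (simp_all add: vec_eq_iff quat_def split: sum.split)

section \<open>Riesz representatives, the structure tensors and the torsion\<close>

lemma riesz_eqI: "(\<And>Z. V \<bullet> Z = f Z) \<Longrightarrow> riesz f = V"
  unfolding riesz_def
  by (rule the_equality) (simp, metis vector_eq_rdot)

lemma inner_riesz:
  assumes "linear f" shows "riesz f \<bullet> Z = f Z"
proof -
  have "(\<Sum>b\<in>Basis. f b *\<^sub>R b) \<bullet> Z = f (\<Sum>b\<in>Basis. (Z \<bullet> b) *\<^sub>R b)" for Z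
    by (simp add: inner_sum_left linear_sum[OF assms] linear_scale[OF assms] mult.commute
        inner_commute[of Z])
  then have V: "(\<Sum>b\<in>Basis. f b *\<^sub>R b) \<bullet> Z = f Z" for Z
    by (simp add: euclidean_representation)
  then have "riesz f = (\<Sum>b\<in>Basis. f b *\<^sub>R b)"
    by (rule riesz_eqI)
  with V show ?thesis by simp
qed

text \<open>The coframe factors 1 / sqrt 2 produce the 1/2. The 2 in the equation defining K and I
  cancels it.\<close>

lemma omega0_eq: "omega0 X Y = sympl (fst X) (fst Y) / 2"
  by (simp add: omega0_def sympl_def wedge11_def eH_def sum_divide_distrib field_simps
      of_real_mult[symmetric] del: of_real_mult)

lemma KK_eq: "KK X = (quat (fst X), 0)"
  unfolding KK_def by (rule riesz_eqI) (simp add: omega0_eq inner_prod_def inner_herm)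

lemma II_eq: "II X = (\<i> *s quat (fst X), 0)"
  unfolding II_def by (rule riesz_eqI) (simp add: omega0_eq inner_prod_def inner_herm)

lemma g_herm:
  "gH X Y = Re (herm (fst X) (fst Y))" "gV X Y = Re (snd X * cnj (snd Y))"
  by (simp_all add: gH_def gV_def inner_herm inner_complex_def)

lemma g_JJ:
  "gH (JJ X) Y = - Im (herm (fst X) (fst Y))" "gV (JJ X) Y = - Im (snd X * cnj (snd Y))"
  by (simp_all add: g_herm JJ_def)

lemma g_KK_II: "gH (KK X) Y = Re (sympl (fst X) (fst Y))" "gH (II X) Y = Im (sympl (fst X) (fst Y))"
  by (simp_all add: g_herm KK_eq II_eq)

text \<open>Three coframe factors give 1 / (2 sqrt 2), and adding the conjugate doubles the real
  part.\<close>

lemma torsion_eq: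
  "torsion l X Y Z = Re (l * (sympl (fst X) (fst Y) * cnj (snd Z) + sympl (fst Y) (fst Z) * cnj (snd X)
     + sympl (fst Z) (fst X) * cnj (snd Y))) / sqrt 2"
proof -
  have T0: "T0 X Y Z = (sympl (fst X) (fst Y) * cnj (snd Z) + sympl (fst Y) (fst Z) * cnj (snd X)
     + sympl (fst Z) (fst X) * cnj (snd Y)) / of_real (2 * sqrt 2)"
    by (simp add: T0_def wedge21_def omega0_eq eV_def add_divide_distrib)
  have *: "Re (l * (E / of_real (2 * c)) + cnj l * cnj (E / of_real (2 * c))) = Re (l * E) / c" for E c
  proof -
    have r: "2 * (r / (2 * c)) = r / c" for r :: real by simp
    have "Re (w + cnj w) = 2 * Re w" for w by simp
    from this[of "l * E / of_real (2 * c)"] show ?thesis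
      by (simp only: Re_divide_of_real r times_divide_eq_right complex_cnj_divide complex_cnj_mult)
  qed
  show ?thesis unfolding torsion_def T0 * by (rule refl)
qed

lemma tvec_torsion:
  "tvec (torsion l) X Y = (1 / sqrt 2) *\<^sub>R
     (cnj l *s (snd X *s quat (fst Y) - snd Y *s quat (fst X)), l * sympl (fst X) (fst Y))"
  unfolding tvec_def
proof (rule riesz_eqI)
  fix Z
  show "(1 / sqrt 2) *\<^sub>R
     (cnj l *s (snd X *s quat (fst Y) - snd Y *s quat (fst X)), l * sympl (fst X) (fst Y)) \<bullet> Z =
     torsion l X Y Z"
    using sympl_commute[of "fst X" "fst Z"]
    by (simp add: torsion_eq inner_prod_def inner_herm inner_complex_def algebra_simps
        add_divide_distrib diff_divide_distrib)
qed

definition tors_prod :: "'n::finite tensor4" where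
  "tors_prod X Y Z W = Re (sympl (fst X) (fst Y) * cnj (sympl (fst Z) (fst W))) / 2 +
     Re (snd X * cnj (snd Z) * herm (fst W) (fst Y) - snd X * cnj (snd W) * herm (fst Z) (fst Y)
       - snd Y * cnj (snd Z) * herm (fst W) (fst X) + snd Y * cnj (snd W) * herm (fst Z) (fst X)) / 2"

text \<open>The phase of \<open>l\<close> acts on torsion vectors by a unitary map, conjugate on
  \<H> and direct on \<V>, so only the modulus survives. Hence \<sigma> and q see only
  |\<lambda>|^2.\<close>

lemma inner_tvec_torsion:
  "tvec (torsion l) X Y \<bullet> tvec (torsion l) Z W = (cmod l)\<^sup>2 * tors_prod X Y Z W"
proof -
  let ?A = "\<lambda>X Y. (cnj l *s (snd X *s quat (fst Y) - snd Y *s quat (fst X)), l * sympl (fst X) (fst Y))"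
  have l: "(cmod l)\<^sup>2 = (Re l)\<^sup>2 + (Im l)\<^sup>2" by (simp add: cmod_power2)
  have "?A X Y \<bullet> ?A Z W = (cmod l)\<^sup>2 * (2 * tors_prod X Y Z W)" unfolding l tors_prod_def
    by (simp add: inner_prod_def inner_herm inner_complex_def
        herm_commute[of "fst W"] herm_commute[of "fst Z"] power2_eq_square)
      (simp add: field_simps)
  moreover have "tvec (torsion l) X Y \<bullet> tvec (torsion l) Z W = (?A X Y \<bullet> ?A Z W) / 2"
    unfolding tvec_torsion inner_scaleR_left inner_scaleR_right by (simp add: real_sqrt_mult[symmetric])
  ultimately show ?thesis by simp
qed

lemma qtensor_torsion:
  "qtensor (torsion l) X Y Z W = (cmod l)\<^sup>2 * qtensor (torsion 1) X Y Z W"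
  by (simp add: qtensor_def inner_tvec_torsion algebra_simps)

lemma sigma_torsion:
  "sigma (torsion l) X Y Z W = (cmod l)\<^sup>2 * sigma (torsion 1) X Y Z W"
  by (simp add: sigma_def bianchi_def inner_tvec_torsion algebra_simps)

lemma tors_prod_skew: "tors_prod Y X Z W = - tors_prod X Y Z W"
  using sympl_commute[of "fst X" "fst Y"] by (simp add: tors_prod_def field_simps)

text \<open>The three terms of q contribute 1/2, 1/4 and 1/4 of \<sigma>, since their cyclic sums
  agree up to skew-symmetry, which absorbs the minus sign.\<close>

lemma bianchi_qtensor: "bianchi (qtensor (torsion l)) X Y Z W = sigma (torsion l) X Y Z W"
  using tors_prod_skew[of Y X Z W] tors_prod_skew[of Z Y X W] tors_prod_skew[of Z X Y W]
  by (simp add: qtensor_def sigma_def bianchi_def inner_tvec_torsion algebra_simps)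

text \<open>The \<open>sp(n)\<close> part of the curvature tensor of quaternionic projective space: \<open>R_HP\<close> without the
  terms \<open>- 2 g(L X, Y) g(L Z, W)\<close>.\<close>

definition sp_part :: "'n::finite tensor4" where
  "sp_part X Y Z W =
     Re (herm (fst Y) (fst Z) * cnj (herm (fst X) (fst W)) + sympl (fst Y) (fst Z) * cnj (sympl (fst X) (fst W)))
   - Re (herm (fst X) (fst Z) * cnj (herm (fst Y) (fst W)) + sympl (fst X) (fst Z) * cnj (sympl (fst Y) (fst W)))"

text \<open>The form g(A X, Y) for A = - J on \<H> and A = - 2 J on \<V>, a generator of u(1). The
  weight 2 comes from the block b^2 of \<rho>.\<close>

definition u_form :: "'n::finite form2" where
  "u_form X Y = Im (herm (fst X) (fst Y)) + 2 * Im (snd X * cnj (snd Y))"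


text \<open>The left-hand side is the curvature of the Hermitian connection with torsion \<open>2 (T\<^sub>0 + cnj T\<^sub>0)\<close>;
  the right-hand side exhibits it as an element of \<open>S\<^sup>2(sp(n)) + S\<^sup>2(u(1))\<close>.\<close>

lemma R0_qtensor:
  "R0 X Y Z W + 4 * qtensor (torsion 1) X Y Z W = sp_part X Y Z W - 2 * u_form X Y * u_form Z W"
  apply (simp add: R0_def R_HP_def Lterm_def g_JJ g_KK_II qtensor_def inner_tvec_torsion)
  apply (simp add: g_herm tors_prod_def sp_part_def u_form_def)
  using sympl_commute[of "fst Y" "fst X"] sympl_commute[of "fst Z" "fst Y"] sympl_commute[of "fst W" "fst Z"]
    herm_commute[of "fst Y" "fst X"] herm_commute[of "fst Z" "fst Y"] herm_commute[of "fst W" "fst Z"]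
     herm_commute[of "fst Z" "fst X"] herm_commute[of "fst W" "fst Y"] herm_commute[of "fst W" "fst X"]
  by (simp add: field_simps)

text \<open>Each bracket of \<open>R0\<close> satisfies the identity by itself. For the last term
  this uses that \<V> is a real plane: the cyclic sum is a 4-form there.\<close>

lemma bianchi_R0: "bianchi R0 X Y Z W = 0"
  apply (simp add: bianchi_def R0_def R_HP_def Lterm_def g_JJ g_KK_II)
  using sympl_commute[of "fst Y" "fst X"] sympl_commute[of "fst Z" "fst Y"] sympl_commute[of "fst Z" "fst X"]
    herm_commute[of "fst Y" "fst X"] herm_commute[of "fst Z" "fst Y"]
     herm_commute[of "fst Z" "fst X"]
  by (simp add: g_herm field_simps)

section \<open>The Lie algebra of the structure group\<close>

definition adj :: "'n::finite mat2n \<Rightarrow> 'n mat2n" where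
  "adj a = (\<chi> i j. cnj (a $ j $ i))"

lemma herm_mult_left: "herm (a *v x) y = herm x (adj a *v y)"
proof -
  have "herm (a *v x) y = (\<Sum>i\<in>UNIV. \<Sum>j\<in>UNIV. a $ i $ j * x $ j * cnj (y $ i))"
    by (simp add: herm_def matrix_vector_mult_def sum_distrib_right)
  also have "\<dots> = (\<Sum>j\<in>UNIV. \<Sum>i\<in>UNIV. a $ i $ j * x $ j * cnj (y $ i))"
    by (rule sum.swap)
  also have "\<dots> = herm x (adj a *v y)"
    by (simp add: herm_def matrix_vector_mult_def adj_def sum_distrib_left mult_ac)
  finally show ?thesis .
qed

lemma herm_nondegenerate: "(\<And>z. herm x z = herm y z) \<Longrightarrow> x = y"
  by (metis inner_herm vector_eq_rdot)

text \<open>\<open>quat\<close> is determined by \<open>herm\<close> and \<open>sympl\<close>, so a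
  map preserving both forms commutes with it. In this way Sp(n) acts by quaternionic maps.\<close>

lemma SpD:
  assumes "a \<in> Sp"
  shows "a *v (adj a *v x) = x" "adj a *v (a *v x) = x"
    "sympl (a *v x) (a *v y) = sympl x y" "herm (a *v x) (a *v y) = herm x y"
    "quat (a *v x) = a *v quat x" "quat (adj a *v x) = adj a *v quat x"
    "herm (adj a *v x) (adj a *v y) = herm x y"
    "sympl (adj a *v x) (adj a *v y) = sympl x y"
proof -
  have 1: "a ** adj a = mat 1" using assms by (simp add: Sp_def U2n_def adj_def)
  then have 2: "adj a ** a = mat 1" using matrix_left_right_inverse by blast
  show r: "a *v (adj a *v x) = x" and l: "adj a *v (a *v x) = x" for x
    using 1 2 by (simp_all add: matrix_vector_mul_assoc)
  show s: "sympl (a *v x) (a *v y) = sympl x y" for x y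
    using assms by (simp add: Sp_def omega0_eq)
  show h: "herm (a *v x) (a *v y) = herm x y" for x y
    by (simp add: herm_mult_left l)
  show q: "quat (a *v x) = a *v quat x" for x
  proof (rule herm_nondegenerate)
    fix z show "herm (quat (a *v x)) z = herm (a *v quat x) z"
      by (subst (1 2) r[symmetric, of z]) (simp only: herm_quat_left s h)
  qed
  show "quat (adj a *v x) = adj a *v quat x"
    by (metis q l r)
  show "herm (adj a *v x) (adj a *v y) = herm x y" "sympl (adj a *v x) (adj a *v y) = sympl x y"
    by (metis h r, metis s r)
qed

lemma adj_adj: "adj (adj a) = a"
  by (simp add: adj_def vec_eq_iff)

lemma Sp_adj: "a \<in> Sp \<Longrightarrow> adj a \<in> Sp"
proof -
  assume a: "a \<in> Sp"
  have "adj a ** a = mat 1" by (simp add: matrix_eq matrix_vector_mul_assoc[symmetric] SpD[OF a])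
  then have "adj a \<in> U2n" unfolding U2n_def using adj_adj[of a] by (simp add: adj_def)
  with SpD(8)[OF a] show ?thesis by (simp add: Sp_def omega0_eq)
qed

lemma inv_rho:
  assumes "a \<in> Sp" "cmod b = 1"
  shows "inv (rho a b) = rho (adj a) (cnj b)"
proof (rule inv_equality)
  have b: "cnj b * b = 1" "b * cnj b = 1"
    using assms(2) by (simp_all add: complex_norm_square[symmetric] mult.commute)
  then have b2: "(cnj b)\<^sup>2 * b\<^sup>2 = 1" "b\<^sup>2 * (cnj b)\<^sup>2 = 1"
    by (simp_all add: power_mult_distrib[symmetric])
  show "rho (adj a) (cnj b) (rho a b x) = x" "rho a b (rho (adj a) (cnj b) x) = x" for x
    using b b2 by (simp_all add: rho_def SpD[OF assms(1)] vec.scale vector_smult_assoc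
       mult.assoc[symmetric])
qed

lemma mem_SpI:
  assumes add: "\<And>x y. g (x + y) = g x + g y" and scale: "\<And>c x. g (c *s x) = c *s g x"
    and herm: "\<And>x y. herm (g x) (g y) = herm x y"
    and sympl: "\<And>x y. sympl (g x) (g y) = sympl x y"
  shows "\<exists>a\<in>Sp. \<forall>x. a *v x = g x"
proof -
  have "Vector_Spaces.linear (*s) (*s) g"
    by unfold_locales (simp_all add: add scale algebra_simps)
  then have g: "matrix g *v x = g x" for x by (rule matrix_works)
  have "herm x (adj (matrix g) *v (matrix g *v y)) = herm x y" for x y
    by (metis herm_mult_left g herm)
  then have "adj (matrix g) *v (matrix g *v y) = y" for y
    by (metis herm_commute herm_nondegenerate)
  then have "adj (matrix g) ** matrix g = mat 1"
    by (simp add: matrix_eq matrix_vector_mul_assoc[symmetric])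
  then have "matrix g ** adj (matrix g) = mat 1" using matrix_left_right_inverse by blast
  then have "matrix g \<in> Sp"
    by (simp add: Sp_def U2n_def adj_def omega0_eq g sympl)
  with g show ?thesis by blast
qed

text \<open>The 2-forms \<open>g(A x, y)\<close> with \<open>A\<close> in \<open>sp(n)\<close>.\<close>

definition spform :: "('n::finite hor \<Rightarrow> 'n hor \<Rightarrow> real) \<Rightarrow> bool" where
  "spform \<alpha> \<longleftrightarrow> bilinear \<alpha> \<and> (\<forall>x y. \<alpha> y x = - \<alpha> x y) \<and>
     (\<forall>x y. \<alpha> (\<i> *s x) (\<i> *s y) = \<alpha> x y) \<and> (\<forall>x y. \<alpha> (quat x) (quat y) = \<alpha> x y)"

lemma inner_tsp: "X \<bullet> Y = Re (herm (fst X) (fst Y) + snd X * cnj (snd Y))"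
  by (simp add: inner_prod_def inner_herm inner_complex_def)

lemma bilinear_sympl: "bilinear sympl"
  by (auto simp: bilinear_def linear_iff scaleR_conv_of_real[where 'a=complex])

lemma bounded_bilinear_sympl: "bounded_bilinear (sympl :: 'n::finite hor \<Rightarrow> _)"
  using bilinear_sympl bilinear_conv_bounded_bilinear by blast

text \<open>Each conclusion is the derivative at 0 of an identity valid on the whole group. The
  factors a and b of a group element are not chosen differentiably in t, so the identities mention
  only the curve itself; b^2, by which \<open>sympl\<close> is scaled, is read off as the action on
  the vertical vector (0, 1).\<close>

lemma lie_algebra_rho_group:
  assumes "A \<in> lie_algebra (rho_group :: ('n::finite tsp \<Rightarrow> _) set)"
  shows "A (X + Y) = A X + A Y" "A (r *\<^sub>R X) = r *\<^sub>R A X" "A (JJ X) = JJ (A X)"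
    "fst (A X) = fst (A (fst X, 0))" "snd (A X) = snd X * snd (A (0, 1))"
    "A X \<bullet> Y = - (X \<bullet> A Y)"
    "sympl (fst (A X)) (fst Y) + sympl (fst X) (fst (A Y)) =
       snd (A (0, 1)) * sympl (fst X) (fst Y)"
proof -
  obtain \<gamma> where \<gamma>: "\<And>t. \<gamma> t \<in> rho_group" and \<gamma>0: "\<gamma> 0 = id"
    and D: "\<And>X. ((\<lambda>t. \<gamma> t X) has_vector_derivative A X) (at 0)"
    using assms unfolding lie_algebra_def by blast
  have grp: "\<exists>a b. \<gamma> t = rho a b \<and> a \<in> Sp \<and> cmod b = 1" for t
    using \<gamma>[of t] by (auto simp: rho_group_def)
  note Df = bounded_linear.has_vector_derivative[OF bounded_linear_fst D]
  note Ds = bounded_linear.has_vector_derivative[OF bounded_linear_snd D]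
  note uniq = vector_derivative_unique_at
  have "\<gamma> t (X + Y) = \<gamma> t X + \<gamma> t Y" for t
    using grp[of t] by (auto simp: rho_def algebra_simps vec.add vec.scale_right_distrib)
  then show "A (X + Y) = A X + A Y"
    using uniq[OF D[of "X + Y"]] has_vector_derivative_add[OF D[of X] D[of Y]] by simp
  have "\<gamma> t (r *\<^sub>R X) = r *\<^sub>R \<gamma> t X" for t
    using grp[of t]
    by (auto simp: rho_def scaleR_eq_smult vec.scale mult.commute vector_smult_assoc scaleR_conv_of_real[where 'a=complex])
  then show "A (r *\<^sub>R X) = r *\<^sub>R A X"
    using uniq[OF D[of "r *\<^sub>R X"]]
     bounded_linear.has_vector_derivative[OF bounded_linear_scaleR_right D[of X]] by simp
  have lJ: "bounded_linear (JJ :: 'n tsp \<Rightarrow> _)"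
    unfolding linear_conv_bounded_linear[symmetric]
    by (auto simp: linear_iff JJ_def scaleR_eq_smult vec.scale vector_smult_assoc mult.commute algebra_simps
        scaleR_conv_of_real[where 'a=complex] vec.scale_right_distrib)
  have "\<gamma> t (JJ X) = JJ (\<gamma> t X)" for t
    using grp[of t] by (auto simp: rho_def JJ_def vec.scale mult.commute vector_smult_assoc)
  then show "A (JJ X) = JJ (A X)"
    using uniq[OF D[of "JJ X"]] bounded_linear.has_vector_derivative[OF lJ D[of X]] by simp
  have "fst (\<gamma> t X) = fst (\<gamma> t (fst X, 0))" for t
    using grp[of t] by (auto simp: rho_def)
  then show "fst (A X) = fst (A (fst X, 0))"
    using uniq[OF Df[of X]] Df[of "(fst X, 0)"] by simp
  have "snd (\<gamma> t X) = snd X * snd (\<gamma> t (0, 1))" for t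
    using grp[of t] by (auto simp: rho_def)
  then show "snd (A X) = snd X * snd (A (0, 1))"
    using uniq[OF Ds[of X]] has_vector_derivative_mult_right[OF Ds[of "(0, 1)"], of "snd X"] by simp
  have iso: "\<gamma> t X \<bullet> \<gamma> t Y = X \<bullet> Y" for t
  proof -
    obtain a b where ab: "\<gamma> t = rho a b" "a \<in> Sp" "cmod b = 1" using grp by blast
    have b: "b * cnj b = 1" using ab(3) by (simp add: complex_norm_square[symmetric])
    have "herm (fst (\<gamma> t X)) (fst (\<gamma> t Y)) = (b * cnj b) * herm (fst X) (fst Y)"
      by (simp add: ab(1) rho_def SpD[OF ab(2)])
    moreover have "snd (\<gamma> t X) * cnj (snd (\<gamma> t Y)) = (b * cnj b)\<^sup>2 * (snd X * cnj (snd Y))"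
      by (simp add: ab(1) rho_def power_mult_distrib mult_ac)
    ultimately show ?thesis by (simp only: inner_tsp b power_one mult_1_left)
  qed
  have "((\<lambda>t. \<gamma> t X \<bullet> \<gamma> t Y) has_vector_derivative (X \<bullet> A Y + A X \<bullet> Y)) (at 0)"
    using bounded_bilinear.has_vector_derivative[OF bounded_bilinear_inner D[of X] D[of Y]] \<gamma>0
    by simp
  then show "A X \<bullet> Y = - (X \<bullet> A Y)"
    unfolding iso using vector_derivative_unique_at[OF has_vector_derivative_const] by fastforce
  have "sympl (fst (\<gamma> t X)) (fst (\<gamma> t Y)) = snd (\<gamma> t (0, 1)) * sympl (fst X) (fst Y)" for t
    using grp[of t] by (auto simp: rho_def SpD power2_eq_square)
  moreover have "((\<lambda>t. sympl (fst (\<gamma> t X)) (fst (\<gamma> t Y))) has_vector_derivative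
      (sympl (fst X) (fst (A Y)) + sympl (fst (A X)) (fst Y))) (at 0)"
    using bounded_bilinear.has_vector_derivative[OF bounded_bilinear_sympl Df[of X] Df[of Y]] \<gamma>0
    by simp
  ultimately show "sympl (fst (A X)) (fst Y) + sympl (fst X) (fst (A Y)) =
       snd (A (0, 1)) * sympl (fst X) (fst Y)"
    using uniq has_vector_derivative_mult_left[OF Ds[of "(0, 1)"], of "sympl (fst X) (fst Y)"]
    by fastforce
qed

lemma rho_formsD:
  assumes "\<phi> \<in> rho_forms"
  shows "\<exists>\<alpha> \<tau>. spform \<alpha> \<and> \<phi> = (\<lambda>X Y. \<alpha> (fst X) (fst Y) + \<tau> * u_form X Y)"
proof -
  obtain A where A: "A \<in> lie_algebra rho_group" and \<phi>: "\<phi> = (\<lambda>X Y. A X \<bullet> Y)"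
    using assms by (auto simp: rho_forms_def)
  note L = lie_algebra_rho_group[OF A]
  \<comment> \<open>Halved because b^2 acts on \<V>, whereas b acts on \<H>.\<close>
  define \<sigma> where "\<sigma> = Im (snd (A (0, 1))) / 2"
  have "A (0, 1) \<bullet> (0, 1) = 0" using L(6)[of "(0,1)" "(0,1)"] by (simp add: inner_commute)
  then have "Re (snd (A (0, 1))) = 0" by (simp add: inner_prod_def inner_complex_def)
  then have s: "snd (A (0, 1)) = 2 * \<i> * of_real \<sigma>" by (simp add: \<sigma>_def complex_eq_iff)
  define f where "f x = fst (A (x, 0))" for x
  have fadd: "f (x + y) = f x + f y" and fsc: "f (r *\<^sub>R x) = r *\<^sub>R f x" and fi: "f (\<i> *s x) = \<i> *s f x"
    for x y r
    using L(1)[of "(x, 0)" "(y, 0)"] L(2)[of r "(x, 0)"] L(3)[of "(x, 0)"] by (simp_all add: f_def JJ_def)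
  have fskew: "f x \<bullet> y = - (x \<bullet> f y)" for x y
    using L(6)[of "(x, 0)" "(y, 0)"] by (simp add: f_def inner_prod_def)
  have fsym: "sympl (f x) y = 2 * \<i> * of_real \<sigma> * sympl x y - sympl x (f y)" for x y
    using L(7)[of "(x, 0)" "(y, 0)"] by (simp add: f_def s algebra_simps)
  \<comment> \<open>This is g((f - i \<sigma>) x, y): the u(1) part, known from \<V>, is removed
    from \<open>f\<close>.\<close>
  define \<alpha> where "\<alpha> x y = f x \<bullet> y + \<sigma> * Im (herm x y)" for x y
  have "spform \<alpha>"
    unfolding spform_def
  proof (intro conjI allI)
    show "bilinear \<alpha>"
      by (auto simp: bilinear_def linear_iff \<alpha>_def fadd fsc algebra_simps inner_add_left inner_add_right)
    fix x y
    show "\<alpha> y x = - \<alpha> x y"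
      using herm_commute[of x y] by (simp add: \<alpha>_def fskew[of x] inner_commute[of x])
    show "\<alpha> (\<i> *s x) (\<i> *s y) = \<alpha> x y" by (simp add: \<alpha>_def fi inner_herm)
    \<comment> \<open>Since \<open>f\<close> rescales \<open>sympl\<close> infinitesimally,
      conjugation by K turns \<open>f\<close> into f - 2 i \<sigma>. The added term \<sigma>
      Im(herm) changes sign under K, which compensates exactly.\<close>
    have "f (quat x) \<bullet> quat y = - Re (sympl (f (quat x)) y)" by (simp add: inner_herm)
    also have "\<dots> = - Re (2 * \<i> * of_real \<sigma> * (- cnj (herm x y)) + cnj (herm x (f y)))"
      unfolding fsym by simp
    also have "\<dots> = f x \<bullet> y + 2 * \<sigma> * Im (herm x y)"
      using fskew[of x y] by (simp add: inner_herm)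
    finally show "\<alpha> (quat x) (quat y) = \<alpha> x y" by (simp add: \<alpha>_def)
  qed
  moreover have fA: "fst (A X) = f (fst X)" for X unfolding f_def by (rule L(4))
  have sA: "snd (A X) = snd X * (2 * \<i> * of_real \<sigma>)" for X using L(5) s by simp
  have "\<phi> = (\<lambda>X Y. \<alpha> (fst X) (fst Y) + (- \<sigma>) * u_form X Y)"
    unfolding \<phi>
    by (simp add: fun_eq_iff inner_prod_def fA sA \<alpha>_def u_form_def inner_complex_def algebra_simps)
  ultimately show ?thesis by blast
qed

text \<open>By skewness u and f u are orthogonal, so Pythagoras gives the norm bound for every real
  \<open>s\<close>, and with it injectivity. The bound also controls the Cayley transform near t =
  0.\<close>

lemma linear_skew_surj:
  fixes f :: "'a::euclidean_space \<Rightarrow> 'a"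
  assumes "linear f" and skew: "\<And>x. f x \<bullet> x = 0"
  shows "\<exists>u. u - s *\<^sub>R f u = x" and "norm u \<le> norm (u - s *\<^sub>R f u)"
proof -
  have norm: "norm u \<le> norm (u - s *\<^sub>R f u)" for u
  proof -
    have "(norm (u - s *\<^sub>R f u))\<^sup>2 = (norm u)\<^sup>2 + s\<^sup>2 * (norm (f u))\<^sup>2"
      unfolding power2_norm_eq_inner
      by (simp add: inner_diff_left inner_diff_right skew inner_commute[of u "f u"] power2_eq_square)
    then have "(norm u)\<^sup>2 \<le> (norm (u - s *\<^sub>R f u))\<^sup>2" by (rule ord_le_eq_trans[rotated, OF sym]) simp
    then show ?thesis by (rule power2_le_imp_le) simp
  qed
  then show "norm u \<le> norm (u - s *\<^sub>R f u)" .
  have "linear (\<lambda>u. u - s *\<^sub>R f u)"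
    using assms(1) by (intro linear_compose_sub linear_compose_scale_right linear_ident)
  moreover have "u = 0" if "u - s *\<^sub>R f u = 0" for u
    using norm[of u] unfolding that by simp
  ultimately have "inj (\<lambda>u. u - s *\<^sub>R f u)" and "linear (\<lambda>u. u - s *\<^sub>R f u)"
    by (auto simp: linear_injective_0)
  then have "surj (\<lambda>u. u - s *\<^sub>R f u)" by (simp add: linear_inj_imp_surj)
  then show "\<exists>u. u - s *\<^sub>R f u = x" unfolding surj_def by (metis (no_types))
qed

lemma bounded_bilinear_smult: "bounded_bilinear (\<lambda>c (x :: 'n::finite hor). c *s x)"
  unfolding bilinear_conv_bounded_bilinear[symmetric] bilinear_def linear_iff
  by (simp add: vec_eq_iff algebra_simps)

text \<open>The curve is the Cayley transform \<open>a(t) = (1 - t f / 2)\<^sup>-\<^sup>1 (1 + t f / 2)\<close>, with \<open>a(t) x\<close> computed as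
  \<open>u + t f(u) / 2\<close> from the solution \<open>u\<close> of \<open>u - t f(u) / 2 = x\<close>.\<close>

lemma cayley_curve:
  fixes f :: "'n::finite hor \<Rightarrow> 'n hor"
  assumes lin: "linear f" and i: "\<And>x. f (\<i> *s x) = \<i> *s f x"
    and skew: "\<And>x y. herm (f x) y = - herm x (f y)"
    and sym: "\<And>x y. sympl (f x) y = - sympl x (f y)"
  shows "\<exists>a. (\<forall>t. a t \<in> Sp) \<and> (\<forall>x. a 0 *v x = x) \<and>
    (\<forall>x. ((\<lambda>t::real. a t *v x) has_vector_derivative f x) (at 0))"
proof -
  have "Re (herm (f x) x) = 0" for x
    using arg_cong[OF skew[of x x], of Re] herm_commute[of x "f x"] by simp
  then have skew0: "f x \<bullet> x = 0" for x by (simp add: inner_herm)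
  note lin_simps = linear_add[OF lin] linear_diff[OF lin] linear_scale[OF lin]
  note surj = linear_skew_surj(1)[OF lin skew0]
  note le = linear_skew_surj(2)[OF lin skew0]
  \<comment> \<open>Full complex linearity is needed for the Cayley transform to be a complex
    matrix.\<close>
  have fc: "f (c *s x) = c *s f x" for c x
  proof -
    have c: "c *s y = Re c *\<^sub>R y + Im c *\<^sub>R (\<i> *s y)" for y :: "'n hor"
      by (simp add: scaleR_eq_smult vec_eq_iff complex_eq_iff)
    show ?thesis by (simp add: c[of x] c[of "f x"] lin_simps i)
  qed
  define u where "u t x = (SOME u. u - (t / 2) *\<^sub>R f u = x)" for t x
  have u: "u t x - (t / 2) *\<^sub>R f (u t x) = x" for t x
    unfolding u_def using surj by (rule someI_ex)
  have uI: "u t x = y" if "y - (t / 2) *\<^sub>R f y = x" for t x y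
  proof -
    have "norm (u t x - y) \<le> norm (u t x - y - (t / 2) *\<^sub>R f (u t x - y))" by (rule le)
    also have "u t x - y - (t / 2) *\<^sub>R f (u t x - y) = 0"
    proof -
      have "u t x - y - (t / 2) *\<^sub>R f (u t x - y)
          = (u t x - (t / 2) *\<^sub>R f (u t x)) - (y - (t / 2) *\<^sub>R f y)"
        by (simp add: lin_simps algebra_simps)
      then show ?thesis by (simp only: u that diff_self)
    qed
    finally show ?thesis by simp
  qed
  define g where "g t x = u t x + (t / 2) *\<^sub>R f (u t x)" for t x
  have uadd: "u t (x + y) = u t x + u t y" for t x y
  proof (rule uI)
    have "u t x + u t y - (t / 2) *\<^sub>R f (u t x + u t y)
        = (u t x - (t / 2) *\<^sub>R f (u t x)) + (u t y - (t / 2) *\<^sub>R f (u t y))"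
      by (simp add: lin_simps algebra_simps)
    then show "u t x + u t y - (t / 2) *\<^sub>R f (u t x + u t y) = x + y" by (simp only: u)
  qed
  have uscale: "u t (c *s x) = c *s u t x" for t c x
    using arg_cong[OF u[of t x], of "\<lambda>x. c *s x"]
    by (intro uI) (simp add: fc scaleR_eq_smult vec.scale_right_diff_distrib vector_smult_assoc mult.commute)
  have "\<exists>a\<in>Sp. \<forall>x. a *v x = g t x" for t
  proof (rule mem_SpI)
    show "g t (x + y) = g t x + g t y" for x y by (simp add: g_def uadd lin_simps algebra_simps)
    show "g t (c *s x) = c *s g t x" for c x
      by (simp add: g_def uscale fc scaleR_eq_smult vec.scale_right_distrib vector_smult_assoc mult.commute)
    show "herm (g t x) (g t y) = herm x y" for x y
    proof -
      \<comment> \<open>The cross terms cancel by skewness for either sign of t, so numerator and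
        denominator of the Cayley transform give the same value of the form.\<close>
      have "herm (g t x) (g t y) = herm (u t x - (t / 2) *\<^sub>R f (u t x)) (u t y - (t / 2) *\<^sub>R f (u t y))"
        by (simp add: g_def skew algebra_simps)
      then show ?thesis by (simp only: u)
    qed
    show "sympl (g t x) (g t y) = sympl x y" for x y
    proof -
      have "sympl (g t x) (g t y) = sympl (u t x - (t / 2) *\<^sub>R f (u t x)) (u t y - (t / 2) *\<^sub>R f (u t y))"
        by (simp add: g_def sym algebra_simps)
      then show ?thesis by (simp only: u)
    qed
  qed
  then obtain a where a: "\<And>t. a t \<in> Sp" "\<And>t x. a t *v x = g t x" by metis
  \<comment> \<open>The difference quotient of the curve is therefore f(u(t) x), and only u(t) x
    \<rightarrow> x has to be estimated.\<close>
  have g: "g t x = x + t *\<^sub>R f (u t x)" for t x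
  proof -
    have "x + t *\<^sub>R f (u t x) = u t x - (t / 2) *\<^sub>R f (u t x) + t *\<^sub>R f (u t x)" by (simp add: u)
    also have "\<dots> = g t x" by (simp add: g_def algebra_simps flip: scaleR_add_left)
    finally show ?thesis by simp
  qed
  have "((\<lambda>t. a t *v x) has_vector_derivative f x) (at 0)" for x
  proof -
    obtain C where C: "\<And>y. norm (f y) \<le> C * norm y" "C > 0" using linear_bounded_pos[OF lin] by blast
    have bnd: "norm (f (u t x) - f x) \<le> \<bar>t\<bar> * (C * C * norm x)" for t
    proof -
      have "u t x - x = (t / 2) *\<^sub>R f (u t x)" using u[of t x] by (simp only: diff_eq_eq add.commute)
      then have "norm (f (u t x) - f x) = (\<bar>t\<bar> / 2) * norm (f (f (u t x)))"
        by (simp add: lin_simps flip: linear_diff[OF lin])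
      also have "\<dots> \<le> \<bar>t\<bar> * (C * (C * norm x))"
      proof (rule mult_mono)
        have "norm (f (f (u t x))) \<le> C * norm (f (u t x))" by (rule C(1))
        also have "\<dots> \<le> C * (C * norm (u t x))" using C by (intro mult_left_mono) auto
        also have "\<dots> \<le> C * (C * norm x)"
          using le[of "u t x" "t / 2"] C(2) by (intro mult_left_mono) (auto simp: u)
        finally show "norm (f (f (u t x))) \<le> C * (C * norm x)" .
      qed auto
      finally show ?thesis by (simp add: mult_ac)
    qed
    show ?thesis
      unfolding has_vector_derivative_def has_derivative_at
    proof
      show "bounded_linear (\<lambda>h. h *\<^sub>R f x)" by (rule bounded_linear_scaleR_left)
      have le: "norm (norm (a (0 + h) *v x - a 0 *v x - h *\<^sub>R f x) / norm h) \<le> \<bar>h\<bar> * (C * C * norm x)" for h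
      proof -
        have "a (0 + h) *v x - a 0 *v x - h *\<^sub>R f x = h *\<^sub>R (f (u h x) - f x)"
          by (simp add: a g algebra_simps)
        then show ?thesis using bnd[of h] by (cases "h = 0") (simp_all add: divide_simps)
      qed
      have "((\<lambda>h. \<bar>h\<bar> * (C * C * norm x)) \<longlongrightarrow> 0) (at 0)"
        by (auto intro!: tendsto_eq_intros)
      then show "(\<lambda>h. norm (a (0 + h) *v x - a 0 *v x - h *\<^sub>R f x) / norm h) \<midarrow>0\<rightarrow> 0"
        by (rule Lim_null_comparison[OF always_eventually[OF allI[OF le]]])
    qed
  qed
  with a g show ?thesis by (intro exI[of _ a]) auto
qed

lemma rho_formsI:
  assumes "spform \<alpha>"
  shows "(\<lambda>X Y. \<alpha> (fst X) (fst Y) + \<tau> * u_form X Y) \<in> (rho_forms :: 'n::finite form2 set)"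
proof -
  have bil: "bilinear \<alpha>" and anti: "\<And>x y. \<alpha> y x = - \<alpha> x y"
    and J: "\<And>x y. \<alpha> (\<i> *s x) (\<i> *s y) = \<alpha> x y" and K: "\<And>x y. \<alpha> (quat x) (quat y) = \<alpha> x y"
    using assms unfolding spform_def by blast+
  define f where "f x = riesz (\<alpha> x)" for x
  have f: "f x \<bullet> y = \<alpha> x y" for x y
    using bil unfolding f_def by (intro inner_riesz) (auto simp: bilinear_def)
  have eqI: "x = y" if "\<And>z. x \<bullet> z = y \<bullet> z" for x y :: "'n hor" using that vector_eq_rdot by blast
  have lin: "linear f"
    by (rule linearI) (rule eqI, simp add: f inner_add_left bilinear_ladd[OF bil] bilinear_lmul[OF bil])+
  have JJ: "\<alpha> (\<i> *s x) y = - \<alpha> x (\<i> *s y)" for x y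
    using J[of x "\<i> *s y"] by (simp add: bilinear_rneg[OF bil])
  have fi: "f (\<i> *s x) = \<i> *s f x" for x
  proof (rule eqI)
    fix z
    have "f (\<i> *s x) \<bullet> z = - (f x \<bullet> (\<i> *s z))" by (simp only: f JJ)
    then show "f (\<i> *s x) \<bullet> z = (\<i> *s f x) \<bullet> z" by (simp add: inner_herm)
  qed
  have fK: "f (quat x) = quat (f x)" for x
  proof (rule eqI)
    fix z
    have "f (quat x) \<bullet> z = \<alpha> (quat x) (quat (- quat z))" by (simp add: f)
    also have "\<dots> = f x \<bullet> (- quat z)" by (simp only: f K)
    also have "\<dots> = quat (f x) \<bullet> z" by (simp add: inner_herm)
    finally show "f (quat x) \<bullet> z = quat (f x) \<bullet> z" .
  qed
  have inner_skew: "f x \<bullet> y = - (x \<bullet> f y)" for x y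
    by (metis anti f inner_commute)
  have skew: "herm (f x) y = - herm x (f y)" for x y
    using inner_skew[of x y] inner_skew[of "\<i> *s x" y] by (simp add: fi inner_herm complex_eq_iff)
  have sym: "sympl (f x) y = - sympl x (f y)" for x y
    using skew[of x "quat y"] by (simp add: fK minus_equation_iff)
  obtain a where a: "\<And>t. a t \<in> Sp" "\<And>x. a 0 *v x = x"
    "\<And>x. ((\<lambda>t::real. a t *v x) has_vector_derivative f x) (at 0)"
    using cayley_curve[OF lin fi skew sym] by blast
  \<comment> \<open>The endomorphism representing \<alpha> + \<tau> \<open>u_form\<close>. The
    exponential in \<open>\<gamma>\<close> is squared on \<V>, which yields the 2 there.\<close>
  define A where "A X = (f (fst X) - (\<i> * of_real \<tau>) *s fst X, - (2 * \<i> * of_real \<tau>) * snd X)" for X :: "'n tsp"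
  define \<gamma> where "\<gamma> t = rho (a t) (exp (- (\<i> * of_real (\<tau> * t))))" for t
  have e: "((\<lambda>t. exp (- (\<i> * of_real (\<tau> * t)))) has_vector_derivative - (\<i> * of_real \<tau>)) (at 0)"
    by (auto intro!: derivative_eq_intros has_vector_derivative_real_field simp: has_field_derivative_def)
  have "A \<in> lie_algebra rho_group"
    unfolding lie_algebra_def
  proof (intro CollectI exI[of _ \<gamma>] conjI allI)
    show "\<gamma> t \<in> rho_group" for t unfolding \<gamma>_def rho_group_def using a(1)
      by (intro CollectI exI[of _ "a t"] exI conjI refl)
        (auto simp: norm_exp_i_times exp_minus norm_inverse simp flip: of_real_mult)
    show "\<gamma> 0 = id" by (auto simp: \<gamma>_def rho_def a(2))
    fix X
    show "((\<lambda>t. \<gamma> t X) has_vector_derivative A X) (at 0)"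
      unfolding \<gamma>_def rho_def A_def power2_eq_square
      using bounded_bilinear.has_vector_derivative[OF bounded_bilinear_smult e a(3)[of "fst X"]]
         has_vector_derivative_mult_left[OF has_vector_derivative_mult[OF e e], of "snd X"]
      by (intro has_vector_derivative_Pair) (simp_all add: a(2) algebra_simps)
  qed
  then have "(\<lambda>X Y. A X \<bullet> Y) \<in> rho_forms" by (auto simp: rho_forms_def)
  moreover have "A X \<bullet> Y = \<alpha> (fst X) (fst Y) + \<tau> * u_form X Y" for X Y
    unfolding f[symmetric]
    by (simp add: A_def inner_prod_def inner_herm u_form_def inner_complex_def algebra_simps)
  ultimately show ?thesis by simp
qed

section \<open>Symmetric squares\<close>

lemma sym_square_prod:
  assumes "\<alpha> \<in> G" "\<beta> \<in> G"
  shows "(\<lambda>X Y Z W. \<alpha> X Y * \<beta> Z W + \<beta> X Y * \<alpha> Z W) \<in> sym_square G"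
  unfolding sym_square_def
  by (intro CollectI exI[of _ "1::nat"] exI[of _ "\<lambda>_. \<alpha>"] exI[of _ "\<lambda>_. \<beta>"]) (simp add: assms)

lemma sym_square_0: "(\<lambda>X Y Z W. 0) \<in> sym_square G"
  unfolding sym_square_def by (intro CollectI exI[of _ "0::nat"]) simp

lemma sym_square_add:
  assumes "R \<in> sym_square G" "S \<in> sym_square G"
  shows "(\<lambda>X Y Z W. R X Y Z W + S X Y Z W) \<in> sym_square G"
proof -
  obtain m :: nat and \<alpha> \<beta> where R: "\<And>i. i < m \<Longrightarrow> \<alpha> i \<in> G \<and> \<beta> i \<in> G"
    "R = (\<lambda>X Y Z W. \<Sum>i<m. \<alpha> i X Y * \<beta> i Z W + \<beta> i X Y * \<alpha> i Z W)"
    using assms(1) unfolding sym_square_def by blast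
  obtain k :: nat and \<alpha>' \<beta>' where S: "\<And>i. i < k \<Longrightarrow> \<alpha>' i \<in> G \<and> \<beta>' i \<in> G"
    "S = (\<lambda>X Y Z W. \<Sum>i<k. \<alpha>' i X Y * \<beta>' i Z W + \<beta>' i X Y * \<alpha>' i Z W)"
    using assms(2) unfolding sym_square_def by blast
  let ?a = "\<lambda>i. if i < m then \<alpha> i else \<alpha>' (i - m)"
  let ?b = "\<lambda>i. if i < m then \<beta> i else \<beta>' (i - m)"
  have split: "(\<Sum>i<m + k. f i) = (\<Sum>i<m. f i) + (\<Sum>i<k. f (m + i))" for f :: "nat \<Rightarrow> real"
    using sum.atLeastLessThan_concat[of 0 m "m + k" f] sum.shift_bounds_nat_ivl[of f 0 m k]
    by (simp add: atLeast0LessThan add.commute)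
  show ?thesis
    unfolding sym_square_def
  proof (rule CollectI, rule exI[of _ "m + k"], rule exI[of _ ?a], rule exI[of _ ?b], intro conjI allI impI)
    show "?a i \<in> G" "?b i \<in> G" if "i < m + k" for i using that R(1) S(1) by auto
    show "(\<lambda>X Y Z W. R X Y Z W + S X Y Z W) =
      (\<lambda>X Y Z W. \<Sum>i<m + k. ?a i X Y * ?b i Z W + ?b i X Y * ?a i Z W)"
      unfolding split R(2) S(2) by simp
  qed
qed

lemma sym_square_sum:
  assumes "finite I" "\<And>i. i \<in> I \<Longrightarrow> R i \<in> sym_square G"
  shows "(\<lambda>X Y Z W. \<Sum>i\<in>I. R i X Y Z W) \<in> sym_square G"
  using assms
proof (induction rule: finite_induct)
  case empty
  show ?case using sym_square_0 by simp
next
  case (insert i I)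
  have i: "R i \<in> sym_square G" by (rule insert.prems) simp
  have I: "(\<lambda>X Y Z W. \<Sum>i\<in>I. R i X Y Z W) \<in> sym_square G"
    by (rule insert.IH) (rule insert.prems, simp)
  show ?case
    unfolding sum.insert[OF insert.hyps] using sym_square_add[OF i I] .
qed

section \<open>Linear structure of the holonomy forms and membership in their symmetric
  square\<close>

lemma spformD:
  assumes "spform \<alpha>"
  shows "bilinear \<alpha>" "\<alpha> y x = - \<alpha> x y" "\<alpha> (\<i> *s x) (\<i> *s y) = \<alpha> x y"
    "\<alpha> (quat x) (quat y) = \<alpha> x y"
  using assms unfolding spform_def by blast+

lemma bilinear_lincomb:
  assumes "bilinear \<alpha>" "bilinear \<beta>"
  shows "bilinear (\<lambda>x y. \<alpha> x y + (c::real) * \<beta> x y)"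
  using assms by (simp add: bilinear_def linear_iff algebra_simps)

lemma spform_lincomb:
  assumes "spform \<alpha>" "spform \<beta>"
  shows "spform (\<lambda>x y. \<alpha> x y + c * \<beta> x y)"
  unfolding spform_def
proof (intro conjI allI)
  show "bilinear (\<lambda>x y. \<alpha> x y + c * \<beta> x y)"
    by (intro bilinear_lincomb spformD(1) assms)
  show "\<alpha> y x + c * \<beta> y x = - (\<alpha> x y + c * \<beta> x y)" for x y
    using spformD(2)[OF assms(1), of y x] spformD(2)[OF assms(2), of y x] by simp
qed (simp_all add: spformD(3,4) assms)

lemma spform_0: "spform (\<lambda>x y. 0)"
  by (simp add: spform_def bilinear_def linear_iff)

lemma rho_forms_0: "(\<lambda>X Y. 0) \<in> rho_forms"
  using rho_formsI[OF spform_0, of 0] by simp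

lemma rho_forms_scale:
  assumes "\<phi> \<in> rho_forms" shows "(\<lambda>X Y. c * \<phi> X Y) \<in> rho_forms"
proof -
  obtain \<alpha> \<tau> where \<phi>: "spform \<alpha>" "\<phi> = (\<lambda>X Y. \<alpha> (fst X) (fst Y) + \<tau> * u_form X Y)"
    using rho_formsD[OF assms] by blast
  show ?thesis using rho_formsI[OF spform_lincomb[OF spform_0 \<phi>(1), of c], of "c * \<tau>"]
    by (simp add: \<phi>(2) algebra_simps)
qed

lemma rho_forms_add:
  assumes "\<phi> \<in> rho_forms" "\<psi> \<in> rho_forms" shows "(\<lambda>X Y. \<phi> X Y + \<psi> X Y) \<in> rho_forms"
proof -
  obtain \<alpha> \<tau> where \<phi>: "spform \<alpha>" "\<phi> = (\<lambda>X Y. \<alpha> (fst X) (fst Y) + \<tau> * u_form X Y)"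
    using rho_formsD[OF assms(1)] by blast
  obtain \<beta> \<sigma> where \<psi>: "spform \<beta>" "\<psi> = (\<lambda>X Y. \<beta> (fst X) (fst Y) + \<sigma> * u_form X Y)"
    using rho_formsD[OF assms(2)] by blast
  show ?thesis using rho_formsI[OF spform_lincomb[OF \<phi>(1) \<psi>(1), of 1], of "\<tau> + \<sigma>"]
    by (simp add: \<phi>(2) \<psi>(2) algebra_simps)
qed

lemma rho_forms_sum:
  assumes "finite I" "\<And>i. i \<in> I \<Longrightarrow> \<phi> i \<in> rho_forms"
  shows "(\<lambda>X Y. \<Sum>i\<in>I. \<phi> i X Y) \<in> rho_forms"
  using assms
proof (induction rule: finite_induct)
  case empty
  show ?case using rho_forms_0 by simp
next
  case (insert i I)
  have i: "\<phi> i \<in> rho_forms" by (rule insert.prems) simp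
  have I: "(\<lambda>X Y. \<Sum>i\<in>I. \<phi> i X Y) \<in> rho_forms"
    by (rule insert.IH) (rule insert.prems, simp)
  show ?case
    unfolding sum.insert[OF insert.hyps] using rho_forms_add[OF i I] .
qed

lemma sym_square_scale:
  assumes "R \<in> sym_square rho_forms"
  shows "(\<lambda>X Y Z W. c * R X Y Z W) \<in> sym_square rho_forms"
proof -
  obtain m :: nat and \<alpha> \<beta> where R: "\<And>i. i < m \<Longrightarrow> \<alpha> i \<in> rho_forms \<and> \<beta> i \<in> rho_forms"
    "R = (\<lambda>X Y Z W. \<Sum>i<m. \<alpha> i X Y * \<beta> i Z W + \<beta> i X Y * \<alpha> i Z W)"
    using assms unfolding sym_square_def by blast
  show ?thesis
    unfolding sym_square_def
    by (intro CollectI exI[of _ m] exI[of _ "\<lambda>i X Y. c * \<alpha> i X Y"] exI[of _ \<beta>])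
      (auto simp: R rho_forms_scale sum_distrib_left algebra_simps)
qed

lemma sym_square_rho_forms:
  assumes "R \<in> sym_square rho_forms"
  shows "R X Y \<in> rho_forms" "R X Y Z W = R Z W X Y"
proof -
  obtain m :: nat and \<alpha> \<beta> where R: "\<And>i. i < m \<Longrightarrow> \<alpha> i \<in> rho_forms \<and> \<beta> i \<in> rho_forms"
    "R = (\<lambda>X Y Z W. \<Sum>i<m. \<alpha> i X Y * \<beta> i Z W + \<beta> i X Y * \<alpha> i Z W)"
    using assms unfolding sym_square_def by blast
  show "R X Y Z W = R Z W X Y" unfolding R(2) by (auto intro!: sum.cong)
  show "R X Y \<in> rho_forms"
    unfolding R(2)
    by (intro rho_forms_sum rho_forms_add rho_forms_scale) (auto simp: R(1))
qed

text \<open>The orthogonal projection of \<open>e \<otimes> f\<close> to \<open>sp(n)\<close>, obtained by averaging over \<open>1, J, K, J K\<close> and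
  antisymmetrising.\<close>

definition sp_proj :: "'n::finite hor \<Rightarrow> 'n hor \<Rightarrow> 'n hor \<Rightarrow> 'n hor \<Rightarrow> real" where
  "sp_proj e f x y = (\<Sum>L\<leftarrow>[\<lambda>x. x, \<lambda>x. \<i> *s x, quat, \<lambda>x. \<i> *s quat x].
     (e \<bullet> L x) * (f \<bullet> L y) - (e \<bullet> L y) * (f \<bullet> L x)) / 8"

lemma spform_sp_proj: "spform (sp_proj e f)"
  unfolding spform_def
proof (intro conjI allI)
  show "bilinear (sp_proj e f)"
    by (auto simp: sp_proj_def bilinear_def linear_iff inner_herm field_simps)
qed (simp_all add: sp_proj_def inner_herm field_simps)

lemma bilinear_expand:
  fixes \<alpha> :: "'a::euclidean_space \<Rightarrow> 'a \<Rightarrow> real"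
  assumes "bilinear \<alpha>"
  shows "(\<Sum>e\<in>Basis. \<Sum>f\<in>Basis. \<alpha> e f * ((e \<bullet> x) * (f \<bullet> y))) = \<alpha> x y"
proof -
  have "\<alpha> x y = \<alpha> (\<Sum>e\<in>Basis. (x \<bullet> e) *\<^sub>R e) (\<Sum>f\<in>Basis. (y \<bullet> f) *\<^sub>R f)"
    by (simp add: euclidean_representation)
  also have "\<dots> = (\<Sum>e\<in>Basis. \<Sum>f\<in>Basis. \<alpha> e f * ((e \<bullet> x) * (f \<bullet> y)))"
    unfolding bilinear_sum[OF assms] sum.cartesian_product
    by (intro sum.cong) (auto simp: bilinear_lmul[OF assms] bilinear_rmul[OF assms] inner_commute)
  finally show ?thesis by simp
qed

text \<open>Each of the four maps L reproduces a form in sp(n), and antisymmetrisation doubles it;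
  hence the divisor 8 in \<open>sp_proj\<close>.\<close>

lemma spform_expand:
  assumes "spform \<alpha>"
  shows "\<alpha> x y = (\<Sum>e\<in>Basis. \<Sum>f\<in>Basis. \<alpha> e f * sp_proj e f x y)"
proof -
  have bil: "bilinear \<alpha>" and anti: "\<And>x y. \<alpha> y x = - \<alpha> x y"
    and J: "\<And>x y. \<alpha> (\<i> *s x) (\<i> *s y) = \<alpha> x y" and K: "\<And>x y. \<alpha> (quat x) (quat y) = \<alpha> x y"
    using assms unfolding spform_def by blast+
  have 1: "(\<Sum>e\<in>Basis. \<Sum>f\<in>Basis. \<alpha> e f * ((e \<bullet> L x) * (f \<bullet> L y) - (e \<bullet> L y) * (f \<bullet> L x))) =
     2 * \<alpha> (L x) (L y)" for L
    using anti[of "L x" "L y"]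
    by (simp add: right_diff_distrib sum_subtractf bilinear_expand[OF bil])
  let ?t = "\<lambda>L e f. (e \<bullet> L x) * (f \<bullet> L y) - (e \<bullet> L y) * (f \<bullet> L x)"
  have "sp_proj e f x y = (?t (\<lambda>x. x) e f + ?t ((*s) \<i>) e f + ?t quat e f + ?t (\<lambda>x. \<i> *s quat x) e f) / 8" for e f
    by (simp add: sp_proj_def)
  then have "(\<Sum>e\<in>Basis. \<Sum>f\<in>Basis. \<alpha> e f * sp_proj e f x y) =
    (2 * \<alpha> x y + 2 * \<alpha> (\<i> *s x) (\<i> *s y) + 2 * \<alpha> (quat x) (quat y)
     + 2 * \<alpha> (\<i> *s quat x) (\<i> *s quat y)) / 8"
    by (simp only: 1[of "\<lambda>x. x"] 1[of "\<lambda>x. \<i> *s quat x"] 1 sum.distrib sum_divide_distrib[symmetric] distrib_left times_divide_eq_right)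
  then show ?thesis by (simp add: J K)
qed

text \<open>Expanding both pairs of arguments by \<open>spform_expand\<close> writes
  \<open>r\<close> as a finite combination of products of \<open>sp_proj\<close> forms, with the
  components of \<open>r\<close> as coefficients.\<close>

lemma sp_tensor_mem:
  assumes sp: "\<And>z w. spform (\<lambda>x y. r x y z w)" and pair: "\<And>x y z w. r x y z w = r z w x y"
  shows "(\<lambda>X Y Z W. r (fst X) (fst Y) (fst Z) (fst W)) \<in> sym_square rho_forms"
proof -
  let ?s = "\<lambda>x y z w. \<Sum>e\<in>Basis. \<Sum>f\<in>Basis. \<Sum>g\<in>Basis. \<Sum>h\<in>Basis.
      r e f g h * (sp_proj e f x y * sp_proj g h z w)"
  have r: "r x y z w = ?s x y z w" for x y z w
  proof -
    have 2: "r e f z w = (\<Sum>g\<in>Basis. \<Sum>h\<in>Basis. r e f g h * sp_proj g h z w)" for e f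
    proof -
      have "r e f z w = (\<Sum>g\<in>Basis. \<Sum>h\<in>Basis. r g h e f * sp_proj g h z w)"
        unfolding pair[of e f] by (rule spform_expand[OF sp])
      also have "\<dots> = (\<Sum>g\<in>Basis. \<Sum>h\<in>Basis. r e f g h * sp_proj g h z w)"
        by (intro sum.cong refl arg_cong2[where f = "(*)"] pair)
      finally show ?thesis .
    qed
    have "r x y z w = (\<Sum>e\<in>Basis. \<Sum>f\<in>Basis. r e f z w * sp_proj e f x y)"
      by (rule spform_expand[OF sp])
    also have "\<dots> = (\<Sum>e\<in>Basis. \<Sum>f\<in>Basis. (\<Sum>g\<in>Basis. \<Sum>h\<in>Basis.
        r e f g h * sp_proj g h z w) * sp_proj e f x y)"
      by (rule sum.cong[OF refl], rule sum.cong[OF refl], subst 2, rule refl)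
    finally show ?thesis by (simp add: sum_distrib_left sum_distrib_right mult_ac)
  qed
  \<comment> \<open>The generators of \<open>sym_square\<close> are symmetrised products, so the
    expansion is averaged with its pair-swapped copy; pair symmetry of \<open>r\<close> makes the
    two equal.\<close>
  let ?t = "\<lambda>x y z w. \<Sum>e\<in>Basis. \<Sum>f\<in>Basis. \<Sum>g\<in>Basis. \<Sum>h\<in>Basis.
      (1/2 * r e f g h * sp_proj e f x y) * sp_proj g h z w
      + sp_proj g h x y * (1/2 * r e f g h * sp_proj e f z w)"
  have t: "?t x y z w = 1/2 * ?s x y z w + 1/2 * ?s z w x y" for x y z w
    by (simp add: sum.distrib sum_distrib_left mult_ac)
  have "r x y z w = ?t x y z w" for x y z w
    unfolding t r[symmetric] using pair[of x y z w] by simp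
  then have r': "(\<lambda>X Y Z W. r (fst X) (fst Y) (fst Z) (fst W)) =
      (\<lambda>X Y Z W. ?t (fst X) (fst Y) (fst Z) (fst W))"
    by (intro ext)
  have sp_mem: "(\<lambda>X Y. c * sp_proj e f (fst X) (fst Y)) \<in> rho_forms" for c e f
    using rho_formsI[OF spform_lincomb[OF spform_0 spform_sp_proj, of c e f], of 0] by simp
  have "(\<lambda>X Y. sp_proj e f (fst X) (fst Y)) \<in> rho_forms" for e f
    using sp_mem[of 1] by simp
  then show ?thesis
    by (subst r') (intro sym_square_sum sym_square_prod sp_mem finite_Basis)
qed

lemma sp_part_eq: "sp_part X Y Z W = sp_part (fst X, 0) (fst Y, 0) (fst Z, 0) (fst W, 0)"
  by (simp add: sp_part_def)

lemma sp_part_mem: "sp_part \<in> sym_square (rho_forms :: 'n::finite form2 set)"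
proof -
  define r :: "'n hor \<Rightarrow> 'n hor \<Rightarrow> 'n hor \<Rightarrow> 'n hor \<Rightarrow> real"
    where "r x y z w = sp_part (x, 0) (y, 0) (z, 0) (w, 0)" for x y z w
  have r: "r x y z w = Re (herm y z * cnj (herm x w) + sympl y z * cnj (sympl x w))
     - Re (herm x z * cnj (herm y w) + sympl x z * cnj (sympl y w))" for x y z w
    by (simp add: r_def sp_part_def)
  have "(\<lambda>X Y Z W. r (fst X) (fst Y) (fst Z) (fst W)) \<in> sym_square rho_forms"
  proof (rule sp_tensor_mem)
    fix x y z w :: "'n hor"
    show "r x y z w = r z w x y"
      using herm_commute[of w x] herm_commute[of w y] herm_commute[of z x] herm_commute[of z y]
        sympl_commute[of w x] sympl_commute[of w y] sympl_commute[of z x] sympl_commute[of z y]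
      by (simp add: r)
    show "spform (\<lambda>x y. r x y z w)"
      unfolding spform_def bilinear_def linear_iff r by (auto simp: algebra_simps)
  qed
  moreover have "sp_part = (\<lambda>X Y Z W. r (fst X) (fst Y) (fst Z) (fst W))"
    unfolding r_def by (intro ext sp_part_eq)
  ultimately show ?thesis by simp
qed

lemma R0_qtensor_mem:
  "(\<lambda>X Y Z W. R0 X Y Z W + 4 * qtensor (torsion 1) X Y Z W) \<in> sym_square rho_forms"
proof -
  have u: "(\<lambda>X Y. c * u_form X Y) \<in> rho_forms" for c
    using rho_formsI[OF spform_0, of c] by simp
  have "u_form \<in> rho_forms" using u[of 1] by simp
  \<comment> \<open>The symmetrised product of \<open>- u_form\<close> and \<open>u_form\<close>
    supplies the coefficient - 2 in \<open>R0_qtensor\<close>.\<close>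
  note sym_square_add[OF sp_part_mem sym_square_prod[OF u[of "-1"] this]]
  moreover have "sp_part X Y Z W - 2 * u_form X Y * u_form Z W =
    sp_part X Y Z W + (- 1 * u_form X Y * u_form Z W + u_form X Y * (- 1 * u_form Z W))" for X Y Z W :: "'a tsp"
    by simp
  ultimately show ?thesis unfolding R0_qtensor by (simp only:)
qed

lemma bianchi_R0_qtensor:
  "bianchi (\<lambda>X Y Z W. R0 X Y Z W + 4 * qtensor (torsion 1) X Y Z W) X Y Z W = 4 * sigma (torsion 1) X Y Z W"
  using bianchi_R0[of X Y Z W] bianchi_qtensor[of 1 X Y Z W] by (simp add: bianchi_def)

section \<open>The kernel of the Bianchi map and symmetric quartic tensors\<close>

text \<open>The mixed component on \<open>\<Lambda>\<^sup>2 \<H> \<otimes> \<Lambda>\<^sup>2 \<V>\<close> is a single term of the Bianchi sum, because the holonomy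
  forms have no \<open>\<H> \<otimes> \<V>\<close> part. Its vanishing kills the \<open>u(1)\<close> coefficient \<open>\<tau>\<close> on horizontal arguments
  directly, and on vertical arguments since \<open>K\<close> fixes the \<open>sp(n)\<close> forms but changes the sign of \<open>g(J x, y)\<close>.\<close>

lemma bianchi_kernel:
  fixes Q :: "'n::finite tensor4"
  assumes Q: "Q \<in> sym_square rho_forms" and b: "\<And>X Y Z W. bianchi Q X Y Z W = 0"
  defines "r \<equiv> \<lambda>x y z w. Q (x, 0) (y, 0) (z, 0) (w, 0)"
  shows "Q X Y Z W = r (fst X) (fst Y) (fst Z) (fst W)" and "spform (r x y)"
    and "r x y z w = r z w x y" and "r x y z w + r y z x w + r z x y w = 0"
proof -
  note pair = sym_square_rho_forms(2)[OF Q]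
  have "\<exists>\<alpha> \<tau>. spform \<alpha> \<and> (\<forall>Z W. Q X Y Z W = \<alpha> (fst Z) (fst W) + \<tau> * u_form Z W)" for X Y
  proof -
    obtain \<alpha> \<tau> where "spform \<alpha>" "Q X Y = (\<lambda>Z W. \<alpha> (fst Z) (fst W) + \<tau> * u_form Z W)"
      using rho_formsD[OF sym_square_rho_forms(1)[OF Q]] by blast
    then show ?thesis by (intro exI[of _ \<alpha>] exI[of _ \<tau>]) simp
  qed
  then have "\<forall>X Y. \<exists>\<alpha> \<tau>. spform \<alpha> \<and> (\<forall>Z W. Q X Y Z W = \<alpha> (fst Z) (fst W) + \<tau> * u_form Z W)"
    by (intro allI)
  then obtain \<alpha> \<tau> where eq': "\<forall>X Y. spform (\<alpha> X Y) \<and>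
      (\<forall>Z W. Q X Y Z W = \<alpha> X Y (fst Z) (fst W) + \<tau> X Y * u_form Z W)"
    unfolding choice_iff by (elim exE)
  from eq' have sp: "spform (\<alpha> X Y)" for X Y by (blast dest: spec)
  from eq' have eq: "Q X Y Z W = \<alpha> X Y (fst Z) (fst W) + \<tau> X Y * u_form Z W" for X Y Z W by (blast dest: spec)
  note zero = bilinear_lzero[OF spformD(1)[OF sp]] bilinear_rzero[OF spformD(1)[OF sp]]
  have HV: "Q X Y (z, 0) (0, \<theta>) = 0" for X Y z \<theta>
    by (simp add: eq zero u_form_def)
  have HHVV: "Q (x, 0) (y, 0) (0, \<zeta>) (0, \<theta>) = 0" for x y \<zeta> \<theta>
    using b[of "(x, 0)" "(y, 0)" "(0, \<zeta>)" "(0, \<theta>)"] by (simp add: bianchi_def HV)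
  have \<tau>H: "\<tau> (x, 0) (y, 0) = 0" for x y
    using HHVV[of x y \<i> 1] by (simp add: eq zero u_form_def)
  have \<tau>V: "\<tau> (0, \<xi>) (0, \<eta>) = 0" for \<xi> \<eta>
  proof -
    have 0: "\<alpha> (0, \<xi>) (0, \<eta>) z w + \<tau> (0, \<xi>) (0, \<eta>) * Im (herm z w) = 0" for z w
      using HHVV[of z w \<xi> \<eta>] pair[of "(0, \<xi>)" "(0, \<eta>)" "(z, 0)" "(w, 0)"] by (simp add: eq u_form_def)
    have 1: "\<tau> (0, \<xi>) (0, \<eta>) * Im (herm z w) = 0" for z w :: "'n hor"
      using 0[of z w] 0[of "quat z" "quat w"] spformD(4)[OF sp] by (simp add: disj_commute)
    \<comment> \<open>Any nonzero vector will do; \<open>undefined\<close> merely names some index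
      of the nonempty index type.\<close>
    define w :: "'n hor" where "w = axis undefined 1"
    have "w \<noteq> 0" by (simp add: w_def)
    then have "Im (herm (\<i> *s w) w) \<noteq> 0" by (simp add: inner_herm[symmetric])
    then show ?thesis using 1[of "\<i> *s w" w] unfolding mult_eq_0_iff by blast
  qed
  have VVVV: "Q (0, \<xi>) (0, \<eta>) (0, \<zeta>) (0, \<theta>) = 0" for \<xi> \<eta> \<zeta> \<theta>
    by (simp add: eq \<tau>V zero)
  have split: "Q X Y Z W = Q X Y (fst Z, 0) (fst W, 0) + Q X Y (0, snd Z) (0, snd W)" for X Y Z W
    by (simp add: eq u_form_def algebra_simps zero)
  have "Q X Y Z W = Q (fst Z, 0) (fst W, 0) X Y + Q (0, snd Z) (0, snd W) X Y"
    using split[of X Y Z W] pair[of X Y] by simp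
  also have "\<dots> = Q (fst Z, 0) (fst W, 0) (fst X, 0) (fst Y, 0)"
    unfolding split[of _ _ X Y] HHVV VVVV
    using HHVV[of "fst X" "fst Y" "snd Z" "snd W"] pair[of "(0, snd Z)" "(0, snd W)" "(fst X, 0)" "(fst Y, 0)"]
    by simp
  finally show "Q X Y Z W = r (fst X) (fst Y) (fst Z) (fst W)" unfolding r_def using pair by presburger
  have "r x y = \<alpha> (x, 0) (y, 0)" unfolding r_def by (simp add: fun_eq_iff eq \<tau>H)
  then show "spform (r x y)" by (simp add: sp)
  show "r x y z w = r z w x y" unfolding r_def by (rule pair)
  show "r x y z w + r y z x w + r z x y w = 0" using b unfolding r_def bianchi_def by blast
qed

text \<open>Acting on one index at a time lets a fourfold contraction be a nest of
  \<open>contr\<close>, so that linearity, exchange of slots and change of basis are all proved for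
  a single index.\<close>

definition contr :: "complex ^ 'm::finite \<Rightarrow> ('m \<Rightarrow> complex) \<Rightarrow> complex" where
  "contr x F = (\<Sum>i\<in>UNIV. cnj (x $ i) * F i)"

definition transf :: "complex ^ 'm::finite ^ 'm \<Rightarrow> ('m \<Rightarrow> complex) \<Rightarrow> 'm \<Rightarrow> complex" where
  "transf a F i = (\<Sum>p\<in>UNIV. a $ i $ p * F p)"

lemma contr_left [simp]:
  "contr (x + y) F = contr x F + contr y F" "contr (- x) F = - contr x F"
  "contr (c *s x) F = cnj c * contr x F" "contr (axis i 1) F = F i"
  by (simp_all add: contr_def algebra_simps sum.distrib sum_negf sum_distrib_left)
    (simp add: axis_def if_distrib[of "\<lambda>z. _ * z"] if_distrib[of "\<lambda>z. z * _"] if_distrib[of cnj] cong: if_cong)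

lemma contr_right [simp]:
  "contr x (\<lambda>i. F i + G i) = contr x F + contr x G" "contr x (\<lambda>i. - F i) = - contr x F"
  "contr x (\<lambda>i. c * F i) = c * contr x F"
  by (simp_all add: contr_def algebra_simps sum.distrib sum_negf sum_distrib_left)

lemma contr_swap: "contr x (\<lambda>i. contr y (\<lambda>j. F i j)) = contr y (\<lambda>j. contr x (\<lambda>i. F i j))"
  unfolding contr_def sum_distrib_left by (subst sum.swap) (simp add: mult_ac)

lemma contr_transf: "contr x (\<lambda>i. transf a F i) = contr (adj a *v x) F"
  unfolding contr_def transf_def sum_distrib_left
  by (subst sum.swap) (simp add: adj_def matrix_vector_mult_def sum_distrib_left sum_distrib_right mult_ac)

lemma contr_transf_swap: "contr x (\<lambda>i. transf a (\<lambda>p. F p i) j) = transf a (\<lambda>p. contr x (F p)) j"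
  unfolding contr_def transf_def sum_distrib_left by (subst sum.swap) (simp add: mult_ac)

text \<open>\<open>qf s\<close> is antilinear in each argument: the components of \<open>s\<close> are contravariant, and the hermitian
  metric identifies \<open>E\<^sup>*\<close> with the conjugate of \<open>E\<close>. This makes \<open>s \<mapsto> qf s\<close> equivariant under unitary matrices.\<close>

definition qf :: "'n::finite quartic \<Rightarrow> 'n hor \<Rightarrow> 'n hor \<Rightarrow> 'n hor \<Rightarrow> 'n hor \<Rightarrow> complex" where
  "qf s x y z w = contr x (\<lambda>i. contr y (\<lambda>j. contr z (\<lambda>k. contr w (\<lambda>l. s $ i $ j $ k $ l))))"

lemma qf_simps [simp]:
  "qf s (x + x') y z w = qf s x y z w + qf s x' y z w"
  "qf s x (y + y') z w = qf s x y z w + qf s x y' z w"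
  "qf s x y (z + z') w = qf s x y z w + qf s x y z' w"
  "qf s x y z (w + w') = qf s x y z w + qf s x y z w'"
  "qf s (- x) y z w = - qf s x y z w" "qf s x (- y) z w = - qf s x y z w"
  "qf s x y (- z) w = - qf s x y z w" "qf s x y z (- w) = - qf s x y z w"
  "qf s (c *s x) y z w = cnj c * qf s x y z w" "qf s x (c *s y) z w = cnj c * qf s x y z w"
  "qf s x y (c *s z) w = cnj c * qf s x y z w" "qf s x y z (c *s w) = cnj c * qf s x y z w"
  by (simp_all add: qf_def)

lemma qf_axis: "qf s (axis i 1) (axis j 1) (axis k 1) (axis l 1) = s $ i $ j $ k $ l"
  by (simp add: qf_def)

lemma quartic_eqI: "(\<And>x y z w. qf s x y z w = qf s' x y z w) \<Longrightarrow> s = s'"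
  unfolding vec_eq_iff by (metis qf_axis)

lemma qf_lincomb:
  "qf (s + s') x y z w = qf s x y z w + qf s' x y z w"
  "qf (c *\<^sub>R s) x y z w = of_real c * qf s x y z w"
  by (simp_all add: qf_def scaleR_conv_of_real[where 'a=complex])

lemma qf_sym:
  assumes "s \<in> S4E"
  shows "qf s x y z w = qf s y x z w" "qf s x y z w = qf s x z y w" "qf s x y z w = qf s x y w z"
proof -
  have s: "s $ i $ j $ k $ l = s $ j $ i $ k $ l" "s $ i $ j $ k $ l = s $ i $ k $ j $ l"
    "s $ i $ j $ k $ l = s $ i $ j $ l $ k" for i j k l
    using assms unfolding S4E_def by blast+
  have "qf s y x z w = contr x (\<lambda>j. contr y (\<lambda>i. contr z (\<lambda>k. contr w (\<lambda>l. s $ i $ j $ k $ l))))"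
    unfolding qf_def by (rule contr_swap)
  then show "qf s x y z w = qf s y x z w" unfolding qf_def using s(1) by presburger
  have "qf s x z y w = contr x (\<lambda>i. contr y (\<lambda>j. contr z (\<lambda>k. contr w (\<lambda>l. s $ i $ k $ j $ l))))"
    unfolding qf_def by (subst contr_swap[of z]) (rule refl)
  then show "qf s x y z w = qf s x z y w" unfolding qf_def using s(2) by presburger
  have "qf s x y w z = contr x (\<lambda>i. contr y (\<lambda>j. contr z (\<lambda>k. contr w (\<lambda>l. s $ i $ j $ l $ k))))"
    unfolding qf_def by (subst contr_swap[of w]) (rule refl)
  then show "qf s x y z w = qf s x y w z" unfolding qf_def using s(3) by presburger
qed

lemma S4_act_nth:
  "S4_act a s $ i $ j $ k $ l =
     transf a (\<lambda>p. transf a (\<lambda>q. transf a (\<lambda>r. transf a (\<lambda>t. s $ p $ q $ r $ t) l) k) j) i"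
  by (simp add: S4_act_def transf_def sum_distrib_left mult_ac)

lemma qf_S4_act: "qf (S4_act a s) x y z w = qf s (adj a *v x) (adj a *v y) (adj a *v z) (adj a *v w)"
  unfolding qf_def S4_act_nth by (simp only: contr_transf_swap contr_transf)

text \<open>The adjoint of \<open>jmat\<close> sends x to minus the conjugate of
  \<open>quat x\<close>; the four minus signs cancel.\<close>

lemma qf_real_structure:
  fixes s :: "'n::finite quartic"
  shows "qf (S4_act jmat (\<chi> i j k l. cnj (s $ i $ j $ k $ l))) x y z w =
     cnj (qf s (quat x) (quat y) (quat z) (quat w))"
proof -
  have jmat: "adj jmat *v x = - (\<chi> i. cnj (quat x $ i))" for x :: "'n hor"
    by (simp add: vec_eq_iff split_sum_all adj_def jmat_def matrix_vector_mult_def sum_plus_type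
        if_distrib[of cnj] if_distrib[of "\<lambda>z. z * _"] cong: if_cong)
  have contr: "contr (\<chi> i. cnj (v $ i)) F = cnj (contr v (\<lambda>i. cnj (F i)))" for v :: "'n hor" and F
    by (simp add: contr_def)
  have "qf (S4_act jmat (\<chi> i j k l. cnj (s $ i $ j $ k $ l))) x y z w =
     qf (\<chi> i j k l. cnj (s $ i $ j $ k $ l)) (\<chi> i. cnj (quat x $ i)) (\<chi> i. cnj (quat y $ i)) (\<chi> i. cnj (quat z $ i)) (\<chi> i. cnj (quat w $ i))"
    unfolding qf_S4_act jmat by simp
  also have "\<dots> = cnj (qf s (quat x) (quat y) (quat z) (quat w))"
    unfolding qf_def contr by simp
  finally show ?thesis .
qed

lemma rS4E_iff:
  "s \<in> rS4E \<longleftrightarrow> s \<in> S4E \<and> (\<forall>x y z w. qf s (quat x) (quat y) (quat z) (quat w) = cnj (qf s x y z w))"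
proof -
  have "(S4_act jmat (\<chi> i j k l. cnj (s $ i $ j $ k $ l)) = s) \<longleftrightarrow>
     (\<forall>x y z w. qf s (quat x) (quat y) (quat z) (quat w) = cnj (qf s x y z w))"
    (is "?s = s \<longleftrightarrow> ?r")
  proof
    assume "?s = s"
    then have "cnj (qf s (quat x) (quat y) (quat z) (quat w)) = qf s x y z w" for x y z w
      using qf_real_structure[of s x y z w] by (simp only:)
    then show ?r by (metis (no_types) complex_cnj_cnj)
  next
    assume r: ?r
    show "?s = s"
      by (intro quartic_eqI) (simp only: qf_real_structure r complex_cnj_cnj)
  qed
  then show ?thesis unfolding rS4E_def by (simp only: mem_Collect_eq)
qed

text \<open>The form \<open>S\<close> of the introduction is \<open>qf s\<close> composed with \<open>quat\<close> in all four arguments.\<close>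

definition hyp :: "'n::finite quartic \<Rightarrow> 'n hor \<Rightarrow> 'n hor \<Rightarrow> 'n hor \<Rightarrow> 'n hor \<Rightarrow> real" where
  "hyp s x y z w = Re (qf s (quat x) y (quat z) w - qf s (quat y) x (quat z) w)"

definition hyper :: "'n::finite quartic \<Rightarrow> 'n tensor4" where
  "hyper s X Y Z W = hyp s (fst X) (fst Y) (fst Z) (fst W)"

text \<open>Reality moves \<open>quat\<close> from slots 1 and 3 to slots 2 and 4 under the real
  part, and this gives the pair symmetry. In the Bianchi sum the six terms cancel in pairs by
  exchanging slots 1 and 3. The form is linear in a slot carrying \<open>quat\<close> and antilinear
  in the others, whence the invariance under J.\<close>

lemma hyp_props:
  assumes "s \<in> rS4E"
  shows "spform (\<lambda>x y. hyp s x y z w)" "hyp s x y z w = hyp s z w x y"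
    "hyp s x y z w + hyp s y z x w + hyp s z x y w = 0"
proof -
  have S: "s \<in> S4E" and R: "\<And>x y z w. qf s (quat x) (quat y) (quat z) (quat w) = cnj (qf s x y z w)"
    using assms rS4E_iff by blast+
  note sym = qf_sym[OF S]
  have re: "Re (qf s (quat x) y (quat z) w) = Re (qf s (quat y) x (quat w) z)" for x y z w
  proof -
    have "Re (qf s (quat x) y (quat z) w) = Re (cnj (qf s (quat x) y (quat z) w))" by simp
    also have "\<dots> = Re (qf s x (quat y) z (quat w))" unfolding R[symmetric] by simp
    also have "\<dots> = Re (qf s (quat y) x (quat w) z)" using sym(1,3) by metis
    finally show ?thesis .
  qed
  have s13: "qf s x y z w = qf s z y x w" for x y z w using sym(1,2) by metis
  have pair: "qf s x y z w = qf s z w x y" for x y z w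
    by (metis s13 sym)
  have "qf s (quat x) y (quat z) w = qf s (quat z) w (quat x) y" by (rule pair)
  moreover have "Re (qf s (quat y) x (quat z) w) = Re (qf s (quat w) z (quat x) y)"
    unfolding re[of y x] by (simp add: pair)
  ultimately show "hyp s x y z w = hyp s z w x y" by (simp add: hyp_def)
  show "spform (\<lambda>x y. hyp s x y z w)"
    unfolding spform_def
  proof (intro conjI allI)
    show "bilinear (\<lambda>x y. hyp s x y z w)"
      by (auto simp: bilinear_def linear_iff hyp_def scaleR_eq_smult algebra_simps)
    show "hyp s (quat x) (quat y) z w = hyp s x y z w" for x y
      using sym(1)[of x "quat y"] sym(1)[of y "quat x"] by (simp add: hyp_def)
  qed (simp_all add: hyp_def)
  show "hyp s x y z w + hyp s y z x w + hyp s z x y w = 0"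
    using s13[of "quat x" y "quat z" w] s13[of "quat y" z "quat x" w] s13[of "quat z" x "quat y" w]
    by (simp add: hyp_def)
qed

text \<open>Recovers \<open>s\<close> from the curvature tensor: the right-hand side extracts the part of \<open>hyp s\<close> that is complex
  linear in the first and third arguments.\<close>

lemma qf_hyp:
  "qf s x y z w = Complex ((hyp s (quat x) y (quat z) w - hyp s (\<i> *s quat x) y (\<i> *s quat z) w) / 2)
     (- (hyp s (\<i> *s quat x) y (quat z) w + hyp s (quat x) y (\<i> *s quat z) w) / 2)"
  by (simp add: hyp_def complex_eq_iff)

lemma hyper_mem: "s \<in> rS4E \<Longrightarrow> hyper s \<in> sym_square rho_forms"
  using sp_tensor_mem[of "hyp s", OF hyp_props(1,2)] by (simp add: hyper_def[abs_def])

lemma bianchi_hyper: "s \<in> rS4E \<Longrightarrow> bianchi (hyper s) X Y Z W = 0"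
  using hyp_props(3) by (simp add: bianchi_def hyper_def)

section \<open>Reconstruction of the quartic tensor from a kernel element\<close>

lemma antilinear_contr:
  assumes "\<And>x y. g (x + y) = g x + g y" "\<And>c x. g (c *s x) = cnj c * g x"
  shows "g x = contr x (\<lambda>i. g (axis i 1))"
proof -
  have g0: "g 0 = 0" using assms(2)[of 0 0] by simp
  have "g (\<Sum>i\<in>I. f i) = (\<Sum>i\<in>I. g (f i))" for I and f :: "'a \<Rightarrow> complex ^ 'a"
    by (induction I rule: infinite_finite_induct) (simp_all add: g0 assms(1))
  then have "g (\<Sum>i\<in>UNIV. x $ i *s axis i 1) = contr x (\<lambda>i. g (axis i 1))"
    by (simp add: contr_def assms(2))
  then show ?thesis by (simp add: basis_expansion)
qed

text \<open>The quartic form \<open>q\<close> inherits exchange of slots 1 and 3 from the Bianchi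
  identity, exchange of 1 and 2 from skewness together with K, and exchange of the two pairs from
  \<open>r\<close>. These generate all permutations of the slots. Invariance under K makes
  \<open>q\<close> real.\<close>

lemma hyp_exists:
  fixes r :: "'n::finite hor \<Rightarrow> 'n hor \<Rightarrow> 'n hor \<Rightarrow> 'n hor \<Rightarrow> real"
  assumes sp: "\<And>x y. spform (r x y)" and pair: "\<And>x y z w. r x y z w = r z w x y"
    and bianchi: "\<And>x y z w. r x y z w + r y z x w + r z x y w = 0"
  shows "\<exists>s\<in>rS4E. \<forall>x y z w. r x y z w = hyp s x y z w"
proof -
  have sp': "spform (\<lambda>x y. r x y z w)" for z w using sp[of z w] by (subst pair) simp
  have skew: "r y x z w = - r x y z w" for x y z w by (rule spformD(2)[OF sp'])
  have bil: "bilinear (\<lambda>x y. r x y z w)" for z w by (rule spformD(1)[OF sp'])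
  have bil': "bilinear (r x y)" for x y by (rule spformD(1)[OF sp])
  note lin = bilinear_ladd[OF bil] bilinear_radd[OF bil] bilinear_ladd[OF bil'] bilinear_radd[OF bil']
   bilinear_lmul[OF bil] bilinear_rmul[OF bil] bilinear_lmul[OF bil'] bilinear_rmul[OF bil']
   bilinear_lneg[OF bil] bilinear_rneg[OF bil] bilinear_lneg[OF bil'] bilinear_rneg[OF bil']
  have ii: "\<i> *s (\<i> *s x) = - x" for x :: "'n hor" by (simp add: vector_smult_assoc)
  have J: "r (\<i> *s x) y z w = - r x (\<i> *s y) z w" for x y z w
    using spformD(3)[OF sp', of x "\<i> *s y" z w] by (simp add: ii lin)
  have K: "r (quat x) y z w = - r x (quat y) z w" for x y z w
    using spformD(4)[OF sp', of x "quat y" z w] by (simp add: lin)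
  have J': "r x y (\<i> *s z) w = - r x y z (\<i> *s w)" for x y z w
    using J[of z w x y] by (simp add: pair[of z] pair[of "\<i> *s z"])
  have K': "r x y (quat z) w = - r x y z (quat w)" for x y z w
    using K[of z w x y] by (simp add: pair[of z] pair[of "quat z"])
  have skewK: "r y (quat x) z w = r x (quat y) z w" and skewJK: "r y (\<i> *s quat x) z w = r x (\<i> *s quat y) z w"
    for x y z w
    using skew[of "quat x" y z w] skew[of "\<i> *s quat x" y z w] by (simp_all add: J K lin)
  \<comment> \<open>The part of \<open>r\<close> that is complex linear in slots 1 and 3. By J it is
    antilinear in slots 2 and 4, and the two \<open>quat\<close> in \<open>q\<close> make all four
    slots antilinear.\<close>
  define F where "F x y z w = Complex ((r x y z w - r (\<i> *s x) y (\<i> *s z) w) / 2)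
     (- (r (\<i> *s x) y z w + r x y (\<i> *s z) w) / 2)" for x y z w
  define q where "q x y z w = F (quat x) y (quat z) w" for x y z w
  \<comment> \<open>The remaining Bianchi term pairs z with x in a J-invariant form, which has no
    part complex linear in both.\<close>
  have F13: "F x y z w = F z y x w" for x y z w
    using bianchi[of x y z w] bianchi[of "\<i> *s x" y "\<i> *s z" w] bianchi[of "\<i> *s x" y z w] bianchi[of x y "\<i> *s z" w]
      skew[of y z x w] skew[of y "\<i> *s z" "\<i> *s x" w] skew[of y z "\<i> *s x" w] skew[of y "\<i> *s z" x w]
    by (simp add: F_def J[of z "\<i> *s x" y w] J[of z x y w] ii lin)
  have q13: "q x y z w = q z y x w" for x y z w unfolding q_def by (rule F13)
  have q12: "q x y z w = q y x z w" for x y z w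
    using skewK[of x y z w] by (simp add: q_def F_def J K J' K' lin skewK[of x y] skewJK[of x y])
  have qpair: "q x y z w = q z w x y" for x y z w
    by (simp add: q_def F_def J K J' K' lin pair[of x] pair[of z w])
  have q34: "q x y z w = q x y w z" for x y z w by (metis q12 qpair)
  have q23: "q x y z w = q x z y w" for x y z w by (metis q12 q13)
  have add: "q (x + x') y z w = q x y z w + q x' y z w" for x x' y z w
    by (simp add: q_def F_def lin complex_eq_iff vec.scale_right_distrib field_simps)
  have scale: "q (c *s x) y z w = cnj c * q x y z w" for c x y z w
  proof -
    have c: "cnj c *s v = Re c *\<^sub>R v - Im c *\<^sub>R (\<i> *s v)" for v :: "'n hor"
      by (simp add: scaleR_eq_smult vec_eq_iff complex_eq_iff)
    have ci: "\<i> *s (t *\<^sub>R v) = t *\<^sub>R (\<i> *s v)" for t :: real and v :: "'n hor"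
      by (simp add: vec_eq_iff scaleR_conv_of_real[where 'a=complex])
    show ?thesis
      by (simp add: q_def F_def c ci ii lin vec.scale_right_diff_distrib bilinear_lsub[OF bil] complex_eq_iff field_simps)
  qed
  have real: "q (quat x) (quat y) (quat z) (quat w) = cnj (q x y z w)" for x y z w
    by (simp add: q_def F_def complex_eq_iff J K J' K' lin ii field_simps)
  define s :: "'n quartic" where "s = (\<chi> i j k l. q (axis i 1) (axis j 1) (axis k 1) (axis l 1))"
  have exp1: "q x y z w = contr x (\<lambda>i. q (axis i 1) y z w)" for x y z w
    by (rule antilinear_contr) (simp_all add: add scale)
  have exp2: "q x y z w = contr y (\<lambda>i. q x (axis i 1) z w)" for x y z w
    by (subst (1 2) q12) (rule exp1)
  have exp3: "q x y z w = contr z (\<lambda>i. q x y (axis i 1) w)" for x y z w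
    by (subst (1 2) qpair) (rule exp1)
  have exp4: "q x y z w = contr w (\<lambda>i. q x y z (axis i 1))" for x y z w
    by (subst (1 2) qpair) (rule exp2)
  have qf: "qf s x y z w = q x y z w" for x y z w
  proof -
    have "q x y z w = contr x (\<lambda>i. contr y (\<lambda>j. contr z (\<lambda>k. contr w (\<lambda>l. q (axis i 1) (axis j 1) (axis k 1) (axis l 1)))))"
      by (subst exp1, subst exp2, subst exp3, subst exp4) (rule refl)
    then show ?thesis by (simp add: qf_def s_def)
  qed
  have "s \<in> S4E" unfolding S4E_def s_def using q12 q23 q34 by simp
  then have "s \<in> rS4E" by (simp add: rS4E_iff qf real)
  \<comment> \<open>On antisymmetrising in x and y, the terms with i in slots 1 and 3 cancel by J,
    while \<open>r\<close> is added to itself and undoes the 1/2 in \<open>F\<close>.\<close>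
  moreover have "r x y z w = hyp s x y z w" for x y z w
    using skew[of x y z w] skew[of "\<i> *s y" x "\<i> *s z" w]
    by (simp add: hyp_def qf q_def F_def lin J[of x] J[of y] ii field_simps)
  ultimately show ?thesis by blast
qed

section \<open>Equivariance, hyper-Kaehler property and contractions\<close>

text \<open>\<open>sympl\<close> alone is only invariant up to b^2; its product with a conjugate
  value is invariant.\<close>

lemma rho_act:
  fixes X Y Z W :: "'n::finite tsp"
  assumes a: "a \<in> Sp" and b: "cmod b = 1"
  shows "herm (fst (rho a b X)) (fst (rho a b Y)) = herm (fst X) (fst Y)"
    "snd (rho a b X) * cnj (snd (rho a b Y)) = snd X * cnj (snd Y)"
    "sympl (fst (rho a b X)) (fst (rho a b Y)) * cnj (sympl (fst (rho a b Z)) (fst (rho a b W))) =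
       sympl (fst X) (fst Y) * cnj (sympl (fst Z) (fst W))"
proof -
  have bb: "b * cnj b = 1" using b by (simp add: complex_norm_square[symmetric])
  have "herm (fst (rho a b X)) (fst (rho a b Y)) = (b * cnj b) * herm (fst X) (fst Y)"
    by (simp add: rho_def SpD[OF a])
  then show "herm (fst (rho a b X)) (fst (rho a b Y)) = herm (fst X) (fst Y)" by (simp add: bb)
  have "snd (rho a b X) * cnj (snd (rho a b Y)) = (b * cnj b)\<^sup>2 * (snd X * cnj (snd Y))"
    by (simp add: rho_def power_mult_distrib mult_ac)
  then show "snd (rho a b X) * cnj (snd (rho a b Y)) = snd X * cnj (snd Y)" by (simp add: bb)
  have "sympl (fst (rho a b X)) (fst (rho a b Y)) * cnj (sympl (fst (rho a b Z)) (fst (rho a b W))) =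
       (b * cnj b) * (b * cnj b) * (sympl (fst X) (fst Y) * cnj (sympl (fst Z) (fst W)))"
    by (simp add: rho_def SpD[OF a] mult_ac)
  then show "sympl (fst (rho a b X)) (fst (rho a b Y)) * cnj (sympl (fst (rho a b Z)) (fst (rho a b W))) =
       sympl (fst X) (fst Y) * cnj (sympl (fst Z) (fst W))" by (simp add: bb)
qed

text \<open>By \<open>R0_qtensor\<close>, \<open>R0\<close> is a polynomial in the invariants of
  \<open>rho_act\<close>, although I and K are not individually invariant.\<close>

lemma R0_rho:
  assumes "a \<in> Sp" "cmod b = 1"
  shows "R0 (rho a b X) (rho a b Y) (rho a b Z) (rho a b W) = R0 X Y Z W"
proof -
  have "R0 X Y Z W = sp_part X Y Z W - 2 * u_form X Y * u_form Z W - 4 * qtensor (torsion 1) X Y Z W"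
    for X Y Z W :: "'a tsp" using R0_qtensor[of X Y Z W] by simp
  then show ?thesis
    by (simp only: sp_part_def u_form_def qtensor_def inner_tvec_torsion tors_prod_def rho_act[OF assms])
qed

text \<open>Two slots are linear and two antilinear, so the phase b cancels: U(1) acts
  trivially.\<close>

lemma hyper_S4_act:
  assumes a: "a \<in> Sp" and b: "cmod b = 1"
  shows "hyper (S4_act a s) X Y Z W =
    hyper s (rho (adj a) (cnj b) X) (rho (adj a) (cnj b) Y) (rho (adj a) (cnj b) Z) (rho (adj a) (cnj b) W)"
proof -
  have bb: "b * cnj b = 1" using b by (simp add: complex_norm_square[symmetric])
  have "qf s (quat (cnj b *s x)) (cnj b *s y) (quat (cnj b *s z)) (cnj b *s w) =
      (b * cnj b) * (b * cnj b) * qf s (quat x) y (quat z) w" for x y z w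
    by simp
  then show ?thesis
    by (simp only: hyper_def hyp_def rho_def fst_conv qf_S4_act SpD(6)[OF a] bb mult_1_left)
qed

lemma curv_op_commute:
  assumes "\<And>Z. linear (R X Y Z)" "\<And>Z W. R X Y (L Z) W = - R X Y Z (L W)"
    "\<And>Z W. L Z \<bullet> W = - (Z \<bullet> L W)"
  shows "curv_op R X Y \<circ> L = L \<circ> curv_op R X Y"
proof
  fix Z
  have "(curv_op R X Y (L Z)) \<bullet> W = L (curv_op R X Y Z) \<bullet> W" for W
    unfolding curv_op_def assms(3) inner_riesz[OF assms(1)] by (rule assms(2))
  then show "(curv_op R X Y \<circ> L) Z = (L \<circ> curv_op R X Y) Z"
    unfolding comp_def using vector_eq_rdot by blast
qed

lemma hyperkaehler_hyper:
  assumes "s \<in> rS4E"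
  shows "hyperkaehler_curvature (hyper s :: 'n::finite tensor4)"
proof -
  note pair = hyp_props(2)[OF assms]
  have sp: "spform (hyp s x y)" for x y
  proof -
    have "hyp s x y = (\<lambda>z w. hyp s z w x y)" by (intro ext pair)
    then show ?thesis using hyp_props(1)[OF assms, of x y] by simp
  qed
  have bil: "bilinear (hyp s x y)" for x y by (rule spformD(1)[OF sp])
  have skew: "hyp s x y w z = - hyp s x y z w" for x y z w by (rule spformD(2)[OF sp])
  have lin: "linear (hyper s X Y Z)" "linear (\<lambda>Z. hyper s X Y Z W)" for X Y Z W :: "'n tsp"
    using bil by (simp_all add: hyper_def[abs_def] bilinear_def linear_iff)
  have hpair: "hyper s X Y Z W = hyper s Z W X Y" for X Y Z W :: "'n tsp"
    unfolding hyper_def by (rule pair)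
  have lin': "linear (\<lambda>X. hyper s X Y Z W)" "linear (\<lambda>Y. hyper s X Y Z W)" for X Y Z W :: "'n tsp"
    by (subst hpair, rule lin)+
  have hskew: "hyper s X Y Z W = - hyper s X Y W Z" for X Y Z W :: "'n tsp"
    unfolding hyper_def by (rule skew)
  have hskew': "hyper s X Y Z W = - hyper s Y X Z W" for X Y Z W :: "'n tsp"
    unfolding hpair[of _ _ Z W] by (rule hskew)
  have "curvature_tensor (hyper s :: 'n tensor4)"
    unfolding curvature_tensor_def
    by (intro conjI allI) (rule lin' lin hskew' hskew hpair bianchi_hyper[OF assms])+
  moreover have "hyper s X Y Z W = hyper s (hproj X) (hproj Y) (hproj Z) (hproj W)" for X Y Z W :: "'n tsp"
    by (simp add: hyper_def hproj_def)
  moreover have "curv_op (hyper s) X Y \<circ> L = L \<circ> curv_op (hyper s) X Y"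
    if "L \<in> {II, JJ, KK}" for X Y :: "'n tsp" and L
  proof (rule curv_op_commute[OF lin(1)])
    note J = spformD(3)[OF sp] and K = spformD(4)[OF sp]
    have J': "hyp s x y (\<i> *s z) w = - hyp s x y z (\<i> *s w)"
      and K': "hyp s x y (quat z) w = - hyp s x y z (quat w)"
      and I': "hyp s x y (\<i> *s quat z) w = - hyp s x y z (\<i> *s quat w)" for x y z w :: "'n hor"
      using J[of x y z "\<i> *s w"] K[of x y z "quat w"] K[of x y "\<i> *s z" "quat (\<i> *s w)"]
         J[of x y "quat z" "\<i> *s w"] K[of x y z "\<i> *s quat w"]
      by (simp_all add: bilinear_rneg[OF bil] bilinear_lneg[OF bil] vector_smult_assoc)
    fix Z W :: "'n tsp"
    show "hyper s X Y (L Z) W = - hyper s X Y Z (L W)"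
      using that J' K' I' by (auto simp: hyper_def II_eq KK_eq JJ_def)
    show "L Z \<bullet> W = - (Z \<bullet> L W)"
      using that sympl_commute[of "fst W" "fst Z"] by (auto simp: inner_tsp II_eq KK_eq JJ_def)
  qed
  ultimately show ?thesis unfolding hyperkaehler_curvature_def by blast
qed

section \<open>Sums over orthonormal bases: Ricci tensors and the norm of the torsion\<close>

lemma sum_Basis_prod:
  fixes f :: "'a::euclidean_space \<times> 'b::euclidean_space \<Rightarrow> 'c::comm_monoid_add"
  shows "(\<Sum>e\<in>Basis. f e) = (\<Sum>x\<in>Basis. f (x, 0)) + (\<Sum>y\<in>Basis. f (0, y))"
proof -
  have "inj_on (\<lambda>u. (u::'a, 0::'b)) Basis" "inj_on (\<lambda>u. (0::'a, u::'b)) Basis"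
    by (auto intro!: inj_onI Pair_inject)
  then show ?thesis
    unfolding Basis_prod_def
    by (subst sum.union_disjoint) (auto simp: sum.reindex)
qed

lemma sum_Basis_complex: "(\<Sum>e\<in>Basis. f (e::complex)) = f 1 + (f \<i> :: 'c::comm_monoid_add)"
  by (simp add: Basis_complex_def)

lemma sum_Basis_hor:
  fixes f :: "complex ^ 'm::finite \<Rightarrow> 'c::comm_monoid_add"
  shows "(\<Sum>e\<in>Basis. f e) = (\<Sum>i\<in>UNIV. f (axis i 1) + f (\<i> *s axis i 1))"
proof -
  have i: "\<i> *s axis i 1 = axis i \<i>" for i :: 'm by (simp add: vec_eq_iff axis_def)
  have "(\<Sum>e\<in>Basis. f e) = (\<Sum>i\<in>UNIV. \<Sum>e\<in>(\<Union>u\<in>Basis. {axis i u}). f e)"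
    unfolding Basis_vec_def by (rule sum.UNION_disjoint) (auto simp: axis_eq_axis)
  also have "\<dots> = (\<Sum>i\<in>UNIV. f (axis i 1) + f (axis i \<i>))"
    by (simp add: Basis_complex_def axis_eq_axis add.commute)
  finally show ?thesis by (simp add: i)
qed

lemma sum_Basis_inner: "(\<Sum>e\<in>Basis. (e \<bullet> u) * (e \<bullet> v)) = u \<bullet> v"
  by (subst euclidean_inner[of u v]) (simp add: inner_commute)

lemma quat_axis: "quat (axis (Inl k) 1) = axis (Inr k) 1" "quat (axis (Inr k) 1) = - axis (Inl k) 1"
  by (auto simp: vec_eq_iff quat_def axis_def split: sum.split)

lemma qf_0 [simp]: "qf s 0 y z w = 0" "qf s x 0 z w = 0" "qf s x y 0 w = 0" "qf s x y z 0 = 0"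
  by (simp_all add: qf_def contr_def)

text \<open>Summing over e and i e leaves the contraction of slots 1 and 4 with the symplectic form,
  because \<open>quat\<close> exchanges paired basis vectors with one sign. It vanishes on a
  symmetric tensor.\<close>

lemma Ric_hyper:
  assumes "s \<in> rS4E" shows "Ric (hyper s) Y Z = 0"
proof -
  have sym: "qf s x y z w = qf s w y z x" for x y z w
    using qf_sym[of s] assms rS4E_iff[of s] by metis
  have "hyp s e y z e + hyp s (\<i> *s e) y z (\<i> *s e) = 2 * Re (qf s (quat e) y (quat z) e)" for e y z
    by (simp add: hyp_def)
  then have "Ric (hyper s) Y Z = (\<Sum>i\<in>UNIV. 2 * Re (qf s (quat (axis i 1)) (fst Y) (quat (fst Z)) (axis i 1)))"
    by (simp add: Ric_def sum_Basis_prod sum_Basis_hor hyper_def hyp_def[of s 0])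
  also have "\<dots> = 0"
    using sym[of "axis (Inl _) 1" "fst Y" "quat (fst Z)" "axis (Inr _) 1"]
    by (simp add: sum_plus_type quat_axis sum_negf)
  finally show ?thesis .
qed

text \<open>Written in products (e \<bullet> u) (e \<bullet> v), so that
  \<open>sum_Basis_inner\<close> evaluates the sum over a basis.\<close>

lemma R0_HH:
  "R0 (e, 0) Y Z (e, 0) = (e \<bullet> e) * (gH Y Z + gV Y Z / 2) - (e \<bullet> fst Y) * (e \<bullet> fst Z)
     + 3 * ((e \<bullet> (\<i> *s fst Y)) * (e \<bullet> (\<i> *s fst Z)))
     + 3/2 * ((e \<bullet> quat (fst Y)) * (e \<bullet> quat (fst Z)))
     + 3/2 * ((e \<bullet> (\<i> *s quat (fst Y))) * (e \<bullet> (\<i> *s quat (fst Z))))"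
  using herm_commute[of "fst Y" e] herm_commute[of "fst Z" e] sympl_commute[of "fst Y" e]
    sympl_commute[of "fst Z" e] sympl_commute[of e e]
  by (simp add: R0_def R_HP_def Lterm_def g_JJ g_KK_II inner_herm)
    (simp add: g_herm herm_def field_simps)

lemma R0_VV:
  "R0 (0, 1) Y Z (0, 1) + R0 (0, \<i>) Y Z (0, \<i>) = gH Y Z + 8 * gV Y Z"
  by (simp add: R0_def R_HP_def Lterm_def g_JJ g_KK_II) (simp add: g_herm)

lemma Ric_R0:
  "Ric R0 Y Z = (4 * real CARD('n) + 6) * gH Y Z + (2 * real CARD('n) + 8) * gV Y (Z :: 'n::finite tsp)"
proof -
  have 1: "(\<Sum>e\<in>(Basis :: 'n hor set). e \<bullet> e) = 4 * real CARD('n)"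
    by simp
  have 2: "(\<i> *s y) \<bullet> (\<i> *s z) = y \<bullet> z" "quat y \<bullet> quat z = y \<bullet> z" for y z :: "'n hor"
    by (simp_all add: inner_herm)
  have "Ric R0 Y Z = (\<Sum>e\<in>Basis. R0 (e, 0) Y Z (e, 0)) + (gH Y Z + 8 * gV Y Z)"
    by (simp add: Ric_def sum_Basis_prod sum_Basis_complex R0_VV)
  \<comment> \<open>The 5 is - 1 + 3 + 3/2 + 3/2, the coefficients of the four products in
    \<open>R0_HH\<close>.\<close>
  also have "(\<Sum>e\<in>Basis. R0 (e, 0) Y Z (e, 0)) = (4 * real CARD('n)) * (gH Y Z + gV Y Z / 2) + 5 * gH Y Z"
    unfolding R0_HH sum.distrib sum_subtractf sum_distrib_left[symmetric] sum_distrib_right[symmetric]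
      sum_Basis_inner 1 2 by (simp add: gH_def)
  finally show ?thesis by (simp add: algebra_simps)
qed

text \<open>Only components with exactly one vertical argument survive. Its three positions
  contribute equally by cyclicity, each 4 n |l|^2.\<close>

lemma norm2_torsion:
  "norm2_form3 (torsion l :: 'n::finite form3) = 12 * real CARD('n) * (cmod l)\<^sup>2"
proof -
  have sq: "(Re (c * cnj 1) / sqrt 2)\<^sup>2 + (Re (c * cnj \<i>) / sqrt 2)\<^sup>2 = (cmod c)\<^sup>2 / 2" for c
    by (simp add: power_divide cmod_power2 add_divide_distrib)
  have "(\<Sum>y\<in>Basis. (cmod (sympl x y))\<^sup>2) = 2 * (x \<bullet> x)" for x :: "'n hor"
  proof -
    have "(cmod (sympl x y))\<^sup>2 = (y \<bullet> quat x) * (y \<bullet> quat x) + (y \<bullet> (\<i> *s quat x)) * (y \<bullet> (\<i> *s quat x))" for y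
      using sympl_commute[of y x] by (simp add: inner_herm cmod_power2 flip: power2_eq_square)
    then show ?thesis by (simp only: sum.distrib sum_Basis_inner) (simp add: inner_herm)
  qed
  then have S: "(\<Sum>x\<in>Basis. \<Sum>y\<in>Basis. (cmod (l * sympl x (y :: 'n hor)))\<^sup>2 / 2) = 4 * real CARD('n) * (cmod l)\<^sup>2"
    by (simp add: norm_mult power_mult_distrib sum_distrib_left[symmetric] sum_divide_distrib[symmetric])
  define t where "t = (torsion l :: 'n form3)"
  have cyc: "t X Y Z = t Y Z X" for X Y Z by (simp add: t_def torsion_eq algebra_simps)
  have HHH: "t (x, 0) (y, 0) (z, 0) = 0" and HVV: "t (x, 0) (0, \<eta>) (0, \<zeta>) = 0"
    and VVV: "t (0, \<xi>) (0, \<eta>) (0, \<zeta>) = 0" for x y z \<xi> \<eta> \<zeta>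
    by (simp_all add: t_def torsion_eq)
  have VHV: "t (0, \<xi>) (y, 0) (0, \<zeta>) = 0" and VVH: "t (0, \<xi>) (0, \<eta>) (z, 0) = 0" for y z \<xi> \<eta> \<zeta>
    using cyc HVV by metis+
  have HHV: "(\<Sum>\<zeta>\<in>Basis. (t (x, 0) (y, 0) (0, \<zeta>))\<^sup>2) = (cmod (l * sympl x y))\<^sup>2 / 2" for x y
    unfolding sum_Basis_complex t_def torsion_eq using sq[of "l * sympl x y"] by (simp add: mult.assoc)
  have HVH: "t (x, 0) (0, \<eta>) (z, 0) = t (z, 0) (x, 0) (0, \<eta>)" and VHH: "t (0, \<xi>) (y, 0) (z, 0) = t (y, 0) (z, 0) (0, \<xi>)"
    for x y z \<xi> \<eta> using cyc by metis+
  have "norm2_form3 t = (\<Sum>x\<in>Basis. \<Sum>y\<in>Basis. \<Sum>\<zeta>\<in>Basis. (t (x, 0) (y, 0) (0, \<zeta>))\<^sup>2)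
    + (\<Sum>x\<in>Basis. \<Sum>\<eta>\<in>Basis. \<Sum>z\<in>Basis. (t (z, 0) (x, 0) (0, \<eta>))\<^sup>2)
    + (\<Sum>\<xi>\<in>Basis. \<Sum>y\<in>Basis. \<Sum>z\<in>Basis. (t (y, 0) (z, 0) (0, \<xi>))\<^sup>2)"
    unfolding norm2_form3_def sum_Basis_prod HHH HVV VVV VHV VVH HVH VHH
    by (simp add: sum.distrib)
  also have "\<dots> = 3 * (\<Sum>x\<in>Basis. \<Sum>y\<in>Basis. \<Sum>\<zeta>\<in>Basis. (t (x, 0) (y, 0) (0, \<zeta>))\<^sup>2)"
  proof -
    have "(\<Sum>x\<in>Basis. \<Sum>\<eta>\<in>Basis. \<Sum>z\<in>Basis. (t (z, 0) (x, 0) (0, \<eta>))\<^sup>2) =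
      (\<Sum>x\<in>Basis. \<Sum>z\<in>Basis. \<Sum>\<eta>\<in>Basis. (t (z, 0) (x, 0) (0, \<eta>))\<^sup>2)"
      by (intro sum.cong refl sum.swap)
    also have "\<dots> = (\<Sum>z\<in>Basis. \<Sum>x\<in>Basis. \<Sum>\<eta>\<in>Basis. (t (z, 0) (x, 0) (0, \<eta>))\<^sup>2)"
      by (rule sum.swap)
    finally have 1: "(\<Sum>x\<in>Basis. \<Sum>\<eta>\<in>Basis. \<Sum>z\<in>Basis. (t (z, 0) (x, 0) (0, \<eta>))\<^sup>2) = \<dots>" .
    have "(\<Sum>\<xi>\<in>Basis. \<Sum>y\<in>Basis. \<Sum>z\<in>Basis. (t (y, 0) (z, 0) (0, \<xi>))\<^sup>2) =
      (\<Sum>y\<in>Basis. \<Sum>\<xi>\<in>Basis. \<Sum>z\<in>Basis. (t (y, 0) (z, 0) (0, \<xi>))\<^sup>2)" by (rule sum.swap)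
    also have "\<dots> = (\<Sum>y\<in>Basis. \<Sum>z\<in>Basis. \<Sum>\<xi>\<in>Basis. (t (y, 0) (z, 0) (0, \<xi>))\<^sup>2)"
      by (intro sum.cong refl sum.swap)
    finally show ?thesis unfolding 1 by simp
  qed
  also have "\<dots> = 12 * real CARD('n) * (cmod l)\<^sup>2" unfolding HHV S by simp
  finally show ?thesis unfolding t_def .
qed

section \<open>The curvature space\<close>

lemma RR_decomposition:
  fixes Ra :: "'n::finite tensor4"
  assumes "Ra \<in> RRa" and c: "bianchi Ra = (\<lambda>X Y Z W. c * sigma (torsion 1) X Y Z W)"
  shows "\<exists>s\<in>rS4E. \<forall>X Y Z W. Ra X Y Z W - c * qtensor (torsion 1) X Y Z W = c / 4 * R0 X Y Z W + hyper s X Y Z W"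
proof -
  let ?P = "\<lambda>X Y Z W. R0 X Y Z W + 4 * qtensor (torsion 1) X Y Z W"
  define Q where "Q = (\<lambda>X Y Z W. Ra X Y Z W + (- (c / 4)) * ?P X Y Z W)"
  have "Ra \<in> sym_square rho_forms" using assms(1) by (simp add: RRa_def)
  then have Q: "Q \<in> sym_square rho_forms"
    unfolding Q_def by (intro sym_square_add sym_square_scale R0_qtensor_mem)
  have "bianchi Q X Y Z W = bianchi Ra X Y Z W - c / 4 * bianchi ?P X Y Z W" for X Y Z W
    by (simp add: Q_def bianchi_def algebra_simps)
  then have b: "bianchi Q X Y Z W = 0" for X Y Z W
    unfolding bianchi_R0_qtensor c by simp
  obtain s where s: "s \<in> rS4E" "\<And>x y z w. Q (x, 0) (y, 0) (z, 0) (w, 0) = hyp s x y z w"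
    using hyp_exists[OF bianchi_kernel(2,3,4)[OF Q b]] by blast
  then have "Q X Y Z W = hyper s X Y Z W" for X Y Z W
    using bianchi_kernel(1)[OF Q b, of X Y Z W] by (simp add: hyper_def)
  then have "Ra X Y Z W - c * qtensor (torsion 1) X Y Z W = c / 4 * R0 X Y Z W + hyper s X Y Z W" for X Y Z W
    unfolding Q_def by (simp add: fun_eq_iff field_simps)
  with s(1) show ?thesis by blast
qed

text \<open>Here c = 4 t runs through all reals; only nonnegative values come from a
  torsion.\<close>

lemma R0_hyper_mem_RR:
  fixes s :: "'n::finite quartic"
  assumes "s \<in> rS4E"
  shows "(\<lambda>X Y Z W. t * R0 X Y Z W + hyper s X Y Z W) \<in> RR"
proof -
  let ?P = "\<lambda>X Y Z W. R0 X Y Z W + 4 * qtensor (torsion 1) X Y Z W"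
  define Ra where "Ra = (\<lambda>X Y Z W. t * ?P X Y Z W + hyper s X Y Z W)"
  have "bianchi Ra X Y Z W = t * bianchi ?P X Y Z W + bianchi (hyper s) X Y Z W" for X Y Z W
    by (simp add: Ra_def bianchi_def algebra_simps)
  then have b: "bianchi Ra = (\<lambda>X Y Z W. (4 * t) * sigma (torsion 1) X Y Z W)"
    unfolding bianchi_R0_qtensor bianchi_hyper[OF assms] by (intro ext) simp
  have "Ra \<in> sym_square rho_forms"
    unfolding Ra_def by (intro sym_square_add sym_square_scale R0_qtensor_mem hyper_mem assms)
  with b have "Ra \<in> RRa" unfolding RRa_def by blast
  moreover have "(\<lambda>X Y Z W. t * R0 X Y Z W + hyper s X Y Z W) =
      (\<lambda>X Y Z W. Ra X Y Z W - (4 * t) * qtensor (torsion 1) X Y Z W)"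
    by (simp add: Ra_def algebra_simps)
  ultimately show ?thesis unfolding RR_def using b by blast
qed

lemma hyper_lincomb:
  "hyper (s + s') X Y Z W = hyper s X Y Z W + hyper s' X Y Z W"
  "hyper (c *\<^sub>R s) X Y Z W = c * hyper s X Y Z W"
  by (simp_all add: hyper_def hyp_def qf_lincomb algebra_simps)

lemma hyper_0: "hyper 0 X Y Z W = 0"
  using hyper_lincomb(2)[of 0] by simp

lemma hyper_inject: "hyper s = hyper s' \<Longrightarrow> s = s'"
proof (rule quartic_eqI)
  assume eq: "hyper s = hyper s'"
  have "hyp s x y z w = hyp s' x y z w" for x y z w
    using fun_cong[OF fun_cong[OF fun_cong[OF fun_cong[OF eq, of "(x, 0)"], of "(y, 0)"], of "(z, 0)"], of "(w, 0)"]
    by (simp add: hyper_def)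
  then show "qf s x y z w = qf s' x y z w" for x y z w
    unfolding qf_hyp[of s] qf_hyp[of s'] by simp
qed

theorem corollary4p3:
  shows "\<exists>\<Phi> :: real \<times> 'n::finite quartic \<Rightarrow> 'n tensor4.
    (\<forall>X Y Z W. linear (\<lambda>p. \<Phi> p X Y Z W)) \<and>
    bij_betw \<Phi> (UNIV \<times> rS4E) RR \<and>
    (\<forall>a\<in>Sp. \<forall>b. cmod b = 1 \<longrightarrow>
       (\<forall>t. \<forall>s\<in>rS4E. \<Phi> (t, S4_act a s) = tensor_act (rho a b) (\<Phi> (t, s)))) \<and>
    (\<forall>R\<in>RR. \<forall>l. corresponding_torsion R l \<longrightarrow>
       (\<exists>t. \<exists>s\<in>rS4E. \<exists>R_hyper.
          R = \<Phi> (t, s) \<and>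
          \<Phi> (t, 0) = (\<lambda>X Y Z W. norm2_form3 (torsion l :: 'n form3) / (48 * real CARD('n)) * R0 X Y Z W) \<and>
          \<Phi> (0, s) = R_hyper \<and>
          hyperkaehler_curvature R_hyper \<and>
          R = (\<lambda>X Y Z W. norm2_form3 (torsion l :: 'n form3) / (48 * real CARD('n)) * R0 X Y Z W
                 + R_hyper X Y Z W)) \<and>
       Ric R = (\<lambda>Y Z. norm2_form3 (torsion l :: 'n form3) / (24 * real CARD('n)) *
                 ((2 * real CARD('n) + 3) * gH Y Z + (real CARD('n) + 4) * gV Y Z)) \<and>
       scal R = (4 * (real CARD('n))\<^sup>2 + 7 * real CARD('n) + 4) *
                 norm2_form3 (torsion l :: 'n form3) / (12 * real CARD('n)))"
proof -
  define \<Phi> :: "real \<times> 'n quartic \<Rightarrow> 'n tensor4" where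
    "\<Phi> p = (\<lambda>X Y Z W. fst p * R0 X Y Z W + hyper (snd p) X Y Z W)" for p
  have n: "real CARD('n) > 0" by simp
  have "linear (\<lambda>p. \<Phi> p X Y Z W)" for X Y Z W
    by (rule linearI) (simp_all add: \<Phi>_def hyper_lincomb algebra_simps)
  moreover have "bij_betw \<Phi> (UNIV \<times> rS4E) RR"
    unfolding bij_betw_def
  proof
    show "inj_on \<Phi> (UNIV \<times> rS4E)"
    proof (rule inj_onI)
      fix p p' assume eq: "\<Phi> p = \<Phi> p'"
      \<comment> \<open>On vertical vectors only the last term of \<open>R0\<close> survives and
        \<open>hyper\<close> vanishes, so this evaluation recovers the real coordinate.\<close>
      have r: "R0 (0 :: 'n hor, \<i>) (0, 1) (0, \<i>) (0, 1) = - 8"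
        by (simp add: R0_def R_HP_def Lterm_def g_JJ g_KK_II) (simp add: g_herm)
      have h: "hyper s (0, \<i>) (0, 1) (0, \<i>) (0, 1) = 0" for s :: "'n quartic"
        by (simp add: hyper_def hyp_def)
      have at: "\<Phi> p X Y Z W = \<Phi> p' X Y Z W" for X Y Z W by (simp only: eq)
      have 1: "fst p = fst p'"
        using at[of "(0, \<i>)" "(0, 1)" "(0, \<i>)" "(0, 1)"] by (simp add: \<Phi>_def r h)
      then have "hyper (snd p) = hyper (snd p')"
        using at by (intro ext) (simp add: \<Phi>_def)
      then show "p = p'" using 1 by (simp add: hyper_inject prod_eq_iff)
    qed
    show "\<Phi> ` (UNIV \<times> rS4E) = RR"
    proof (intro equalityI subsetI)
      fix R assume "R \<in> \<Phi> ` (UNIV \<times> rS4E)"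
      then show "R \<in> RR" by (auto simp: \<Phi>_def R0_hyper_mem_RR)
    next
      fix R :: "'n tensor4" assume "R \<in> RR"
      then obtain Ra c where Ra: "Ra \<in> RRa" "bianchi Ra = (\<lambda>X Y Z W. c * sigma (torsion 1) X Y Z W)"
        and R: "R = (\<lambda>X Y Z W. Ra X Y Z W - c * qtensor (torsion 1) X Y Z W)"
        unfolding RR_def by blast
      obtain s where s: "s \<in> rS4E" and eq: "\<And>X Y Z W. Ra X Y Z W - c * qtensor (torsion 1) X Y Z W =
          c / 4 * R0 X Y Z W + hyper s X Y Z W"
        using RR_decomposition[OF Ra] by blast
      have "R = \<Phi> (c / 4, s)" unfolding R \<Phi>_def by (intro ext) (simp add: eq)
      with s show "R \<in> \<Phi> ` (UNIV \<times> rS4E)" by blast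
    qed
  qed
  moreover have "\<Phi> (t, S4_act a s) = tensor_act (rho a b) (\<Phi> (t, s))"
    if "a \<in> Sp" "cmod b = 1" for a b t s
  proof -
    have "cmod (cnj b) = 1" using that by simp
    with that show ?thesis
      by (intro ext) (simp add: \<Phi>_def tensor_act_def inv_rho hyper_S4_act R0_rho Sp_adj)
  qed
  moreover have "(\<exists>t. \<exists>s\<in>rS4E. \<exists>R_hyper.
          R = \<Phi> (t, s) \<and>
          \<Phi> (t, 0) = (\<lambda>X Y Z W. norm2_form3 (torsion l :: 'n form3) / (48 * real CARD('n)) * R0 X Y Z W) \<and>
          \<Phi> (0, s) = R_hyper \<and>
          hyperkaehler_curvature R_hyper \<and>
          R = (\<lambda>X Y Z W. norm2_form3 (torsion l :: 'n form3) / (48 * real CARD('n)) * R0 X Y Z W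
                 + R_hyper X Y Z W)) \<and>
       Ric R = (\<lambda>Y Z. norm2_form3 (torsion l :: 'n form3) / (24 * real CARD('n)) *
                 ((2 * real CARD('n) + 3) * gH Y Z + (real CARD('n) + 4) * gV Y Z)) \<and>
       scal R = (4 * (real CARD('n))\<^sup>2 + 7 * real CARD('n) + 4) *
                 norm2_form3 (torsion l :: 'n form3) / (12 * real CARD('n))"
    if cor: "corresponding_torsion R l" for R :: "'n tensor4" and l
  proof -
    let ?N = "norm2_form3 (torsion l :: 'n form3)"
    obtain Ra where Ra: "Ra \<in> RRa" "bianchi Ra = sigma (torsion l)"
      and R: "R = (\<lambda>X Y Z W. Ra X Y Z W - qtensor (torsion l) X Y Z W)"
      using cor unfolding corresponding_torsion_def by blast
    have "bianchi Ra = (\<lambda>X Y Z W. (cmod l)\<^sup>2 * sigma (torsion 1) X Y Z W)"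
      unfolding Ra(2) by (intro ext sigma_torsion)
    from RR_decomposition[OF Ra(1) this] obtain s where s: "s \<in> rS4E"
      and "\<And>X Y Z W. Ra X Y Z W - (cmod l)\<^sup>2 * qtensor (torsion 1) X Y Z W =
        (cmod l)\<^sup>2 / 4 * R0 X Y Z W + hyper s X Y Z W" by blast
    moreover have N: "?N / (48 * real CARD('n)) = (cmod l)\<^sup>2 / 4"
      using n by (simp add: norm2_torsion field_simps)
    ultimately have R': "R X Y Z W = ?N / (48 * real CARD('n)) * R0 X Y Z W + hyper s X Y Z W" for X Y Z W
      unfolding R N qtensor_torsion[of l] by blast
    \<comment> \<open>The summand 0 stands for the Ricci tensor of the hyper-Kaehler part, so that
      \<open>e\<close> rewrites the sum as it appears after \<open>Ric_hyper\<close>.\<close>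
    have e: "a / (48 * m) * ((4 * m + 6) * g + (2 * m + 8) * h) + 0 =
        a / (24 * m) * ((2 * m + 3) * g + (m + 4) * h)" if "m > 0" for a g h m :: real
      using that by (simp add: field_simps)
    have "Ric R Y Z = ?N / (48 * real CARD('n)) * Ric R0 Y Z + Ric (hyper s) Y Z" for Y Z
      by (simp add: Ric_def R' sum.distrib sum_distrib_left)
    then have Ric: "Ric R Y Z = ?N / (24 * real CARD('n)) *
        ((2 * real CARD('n) + 3) * gH Y Z + (real CARD('n) + 4) * gV Y Z)" for Y Z
      by (simp only: Ric_R0 Ric_hyper[OF s] e[OF n])
    have g: "(\<Sum>e\<in>(Basis :: 'n tsp set). gH e e) = 4 * real CARD('n)" "(\<Sum>e\<in>(Basis :: 'n tsp set). gV e e) = 2"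
      by (simp_all add: sum_Basis_prod gH_def gV_def)
    have "scal R = ?N / (24 * real CARD('n)) * ((2 * real CARD('n) + 3) * (4 * real CARD('n)) + (real CARD('n) + 4) * 2)"
      by (simp only: scal_def Ric sum_distrib_left[symmetric] sum.distrib g)
    also have "\<dots> = (4 * (real CARD('n))\<^sup>2 + 7 * real CARD('n) + 4) * ?N / (12 * real CARD('n))"
      using n by (simp add: field_simps power2_eq_square)
    finally have scal: "scal R = (4 * (real CARD('n))\<^sup>2 + 7 * real CARD('n) + 4) * ?N / (12 * real CARD('n))" .
    show ?thesis
    proof (intro conjI exI bexI)
      show "R = \<Phi> (?N / (48 * real CARD('n)), s)" by (intro ext) (simp add: \<Phi>_def R')
      show "\<Phi> (?N / (48 * real CARD('n)), 0) = (\<lambda>X Y Z W. ?N / (48 * real CARD('n)) * R0 X Y Z W)"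
        by (simp add: \<Phi>_def hyper_0)
      show "\<Phi> (0, s) = hyper s" by (simp add: \<Phi>_def)
      show "hyperkaehler_curvature (hyper s)" by (rule hyperkaehler_hyper[OF s])
      show "R = (\<lambda>X Y Z W. ?N / (48 * real CARD('n)) * R0 X Y Z W + hyper s X Y Z W)" by (intro ext R')
      show "Ric R = (\<lambda>Y Z. ?N / (24 * real CARD('n)) *
        ((2 * real CARD('n) + 3) * gH Y Z + (real CARD('n) + 4) * gV Y Z))" by (intro ext Ric)
    qed (rule s scal)+
  qed
  ultimately show ?thesis by (intro exI[of _ \<Phi>]) blast
qed

end
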